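(* For every $i\in\{1,2,3,4,5\}$ and every integer $n\ge 0$, $|\mathcal{M}_n(P_i)|=C_n$, where $C_n=\frac{1}{n+1}\binom{2n}{n}$ is the $n$-th Catalan number.
   Context: A matching of length $n$ is a partition of $\{1,2,\ldots,2n\}$ into blocks of size 2, called arcs. An arc is written $[a,b]$ with $a<b$; $a$ is its opener and $b$ its closer. A matching is a Stoimenow matching if it contains neither a pair of arcs $[i,\ell],[i+1,k]$ with $i+1<k<\ell$ (Type I) nor a pair of arcs $[k,j+1],[\ell,j]$ with $k<\ell<j$ (Type II). $\mathcal{M}_n$ is the set of Stoimenow matchings of length $n$ ($\mathcal{M}_0$ consists of the empty matching). A matching contains a pattern (another matching) if, after removing some (possibly no) arcs and relabelling the remaining endpoints increasingly by $1,2,\ldots$, one obtains that pattern; otherwise it avoids the pattern. The patterns are $P_1=\{[1,3],[2,7],[4,5],[6,8]\}$, $P_2=\{[1,3],[2,5],[4,7],[6,8]\}$, $P_3=\{[1,2],[3,5],[4,6],[7,8]\}$, $P_4=\{[1,2],[3,5],[4,7],[6,8]\}$, $P_5=\{[1,3],[2,5],[4,6],[7,8]\}$. $\mathcal{M}_n(P_i)$ is the set of matchings in $\mathcal{M}_n$ that avoid $P_i$. *)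

theory Defs
  imports Complex_Main "HOL-Library.Disjoint_Sets"
begin

text \<open>
  A matching is represented by its set of blocks. The arc \<open>[a,b]\<close> with \<open>a < b\<close> is the
  two-element set \<open>{a, b}\<close>; since a set does not record which element is the opener, the
  inequality \<open>a < b\<close> has to be stated wherever it matters.
\<close>

definition matching :: "nat \<Rightarrow> nat set set \<Rightarrow> bool" where
  "matching n M \<longleftrightarrow> partition_on {1..2 * n} M \<and> (\<forall>A\<in>M. card A = 2)"

definition is_arc :: "nat set set \<Rightarrow> nat \<Rightarrow> nat \<Rightarrow> bool" where
  "is_arc M a b \<longleftrightarrow> a < b \<and> {a, b} \<in> M"

definition type_I :: "nat set set \<Rightarrow> bool" where
  "type_I M \<longleftrightarrow> (\<exists>i k l. is_arc M i l \<and> is_arc M (i + 1) k \<and> i + 1 < k \<and> k < l)"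

definition type_II :: "nat set set \<Rightarrow> bool" where
  "type_II M \<longleftrightarrow> (\<exists>j k l. is_arc M k (j + 1) \<and> is_arc M l j \<and> k < l \<and> l < j)"

definition stoimenow_matchings :: "nat \<Rightarrow> nat set set set" where
  "stoimenow_matchings n = {M. matching n M \<and> \<not> type_I M \<and> \<not> type_II M}"

text \<open>
  The endpoint \<open>x\<close> of a finite set of arcs \<open>N\<close> receives as its new label its rank
  (starting from \<open>1\<close>) among all the endpoints of \<open>N\<close>.
\<close>

definition relabel :: "nat set set \<Rightarrow> nat set set" where
  "relabel N = (\<lambda>A. (\<lambda>x. card {y \<in> \<Union>N. y \<le> x}) ` A) ` N"

definition contains_pattern :: "nat set set \<Rightarrow> nat set set \<Rightarrow> bool" where
  "contains_pattern M P \<longleftrightarrow> (\<exists>N. N \<subseteq> M \<and> relabel N = P)"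

definition stoimenow_avoiding :: "nat \<Rightarrow> nat set set \<Rightarrow> nat set set set" where
  "stoimenow_avoiding n P = {M \<in> stoimenow_matchings n. \<not> contains_pattern M P}"

definition P1 :: "nat set set" where "P1 = {{1, 3}, {2, 7}, {4, 5}, {6, 8}}"
definition P2 :: "nat set set" where "P2 = {{1, 3}, {2, 5}, {4, 7}, {6, 8}}"
definition P3 :: "nat set set" where "P3 = {{1, 2}, {3, 5}, {4, 6}, {7, 8}}"
definition P4 :: "nat set set" where "P4 = {{1, 2}, {3, 5}, {4, 7}, {6, 8}}"
definition P5 :: "nat set set" where "P5 = {{1, 3}, {2, 5}, {4, 6}, {7, 8}}"

definition catalan :: "nat \<Rightarrow> real" where
  "catalan n = 1 / (real n + 1) * real ((2 * n) choose n)"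

end

theory Submission
  imports Defs "HOL-Library.FuncSet" "HOL-Combinatorics.Transposition"
begin

text \<open>
  Number the arcs of a matching by their openers, and let \<open>g a\<close> be the number of openers to the
  left of the closer of arc \<open>a\<close>, so \<open>a \<le> g a \<le> n\<close>. In the absence of type II pairs the matching
  can be recovered from \<open>g\<close>, since the closers lying between two consecutive openers
  are ordered like their openers. Type I pairs are absent iff \<open>g a \<le> g (a + 1)\<close>
  whenever \<open>a\<close> is not a value of \<open>g\<close>, that is, whenever arcs \<open>a\<close> and \<open>a + 1\<close> open in the same run.

  Avoiding \<open>P1\<close> means that \<open>g\<close> is monotone. For the other patterns there is a relation \<open>R\<close> on arcs,
  depending only on the image of \<open>g\<close>, such that avoidance forbids \<open>R x y\<close> together with
  \<open>y \<le> g x < g y\<close> (\<open>P2\<close>, \<open>P4\<close>) or with \<open>y \<le> g x \<le> g y < n\<close> (\<open>P5\<close>, \<open>P3\<close>): for \<open>P2\<close> and \<open>P5\<close>, the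
  arcs \<open>x < y\<close> open in different runs; for \<open>P4\<close> and \<open>P3\<close>, the arc \<open>x < y\<close> does not open in the first run.
  A bijection between the two kinds of maps postpones to the last slot \<open>n\<close> every arc that closes
  together with an arc \<open>R\<close>-related to it. Both \<open>P1\<close>- and \<open>P2\<close>-avoidance pick exactly one map for each
  admissible sequence of fibre sizes: at every slot the open arcs that come first in a fixed
  priority order are closed. Finally, reflection exchanges \<open>P4\<close> and \<open>P5\<close>.
\<close>

section \<open>Maps from arcs to closing slots\<close>

definition slot_maps :: "nat \<Rightarrow> (nat \<Rightarrow> nat) set" where
  "slot_maps n = (\<Pi>\<^sub>E a\<in>{1..n}. {a..n})"

definition runs_sorted :: "nat \<Rightarrow> (nat \<Rightarrow> nat) \<Rightarrow> bool" where
  "runs_sorted n g \<longleftrightarrow> (\<forall>a\<in>{1..<n}. a \<notin> g ` {1..n} \<longrightarrow> g a \<le> g (Suc a))"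

text \<open>For \<open>x < y\<close>, the inequalities \<open>y \<le> g x < g y\<close> say that
  arcs \<open>x\<close> and \<open>y\<close> cross and that some arc opens between their closers.
  The relation sees only the image of \<open>g\<close>, which records the runs of openers and is
  preserved by the bijection below.\<close>

definition strict_avoiders :: "(nat set \<Rightarrow> nat \<Rightarrow> nat \<Rightarrow> bool) \<Rightarrow> nat \<Rightarrow> (nat \<Rightarrow> nat) set" where
  "strict_avoiders R n = {g \<in> slot_maps n. runs_sorted n g \<and>
     \<not> (\<exists>x\<in>{1..n}. \<exists>y\<in>{1..n}. R (g ` {1..n}) x y \<and> y \<le> g x \<and> g x < g y)}"

text \<open>For \<open>x < y\<close>, the inequalities \<open>y \<le> g x \<le> g y\<close> say that
  the arcs cross, and \<open>g y < n\<close> that arc \<open>n\<close> opens after both have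
  closed.\<close>

definition weak_avoiders :: "(nat set \<Rightarrow> nat \<Rightarrow> nat \<Rightarrow> bool) \<Rightarrow> nat \<Rightarrow> (nat \<Rightarrow> nat) set" where
  "weak_avoiders R n = {g \<in> slot_maps n. runs_sorted n g \<and>
     \<not> (\<exists>x\<in>{1..n}. \<exists>y\<in>{1..n}. R (g ` {1..n}) x y \<and> y \<le> g x \<and> g x \<le> g y \<and> g y < n)}"

lemma finite_slot_maps: "finite (slot_maps n)"
  unfolding slot_maps_def by (intro finite_PiE) auto

lemma slot_maps_iff: "g \<in> slot_maps n \<longleftrightarrow> g \<in> extensional {1..n} \<and> (\<forall>a\<in>{1..n}. a \<le> g a \<and> g a \<le> n)"
  unfolding slot_maps_def PiE_def Pi_def by auto

lemma slot_maps_eqI: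
  "f \<in> slot_maps n \<Longrightarrow> g \<in> slot_maps n \<Longrightarrow> (\<And>a. a \<in> {1..n} \<Longrightarrow> f a = g a) \<Longrightarrow> f = g"
  unfolding slot_maps_iff by (blast intro: extensionalityI)

lemma slot_maps_last: "g \<in> slot_maps n \<Longrightarrow> 1 \<le> n \<Longrightarrow> g n = n"
  by (auto simp: slot_maps_iff intro: antisym)

lemma slot_maps_image: "g \<in> slot_maps n \<Longrightarrow> g ` {1..n} \<subseteq> {1..n}"
  by (force simp: slot_maps_iff)

section \<open>Blocking relations between arcs\<close>

definition separated :: "nat set \<Rightarrow> nat \<Rightarrow> nat \<Rightarrow> bool" where
  "separated I x y \<longleftrightarrow> (\<exists>c\<in>I. x \<le> c \<and> c < y)"

text \<open>In this relation and in \<open>separated\<close>, the elements of \<open>I\<close> are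
  occupied slots: a slot \<open>c\<close> with \<open>x \<le> c < y\<close> places a closer between
  the openers of \<open>x\<close> and \<open>y\<close>, and a slot \<open>c < x\<close> places one
  before the opener of \<open>x\<close>.\<close>

definition past_first :: "nat set \<Rightarrow> nat \<Rightarrow> nat \<Rightarrow> bool" where
  "past_first I x y \<longleftrightarrow> x < y \<and> (\<exists>c\<in>I. c < x)"

text \<open>What the bijection uses of the two relations: \<open>trans\<close> lets an arc be traced
  back to the arc that provides its slot, while \<open>mono_right\<close> and
  \<open>run_left\<close> carry a relation between neighbouring arcs \<open>a\<close> and
  \<open>Suc a\<close>, so that runs stay sorted.\<close>

locale blocking =
  fixes R :: "nat set \<Rightarrow> nat \<Rightarrow> nat \<Rightarrow> bool"
  assumes less: "R I x y \<Longrightarrow> x < y"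
    and trans: "R I x y \<Longrightarrow> R I y z \<Longrightarrow> R I x z"
    and mono_right: "R I x y \<Longrightarrow> y < z \<Longrightarrow> R I x z"
    and run_left: "R I z (Suc a) \<Longrightarrow> z < a \<Longrightarrow> a \<notin> I \<Longrightarrow> R I z a"

lemma blocking_separated: "blocking separated"
proof
  fix I x y z and a :: nat
  show "separated I x y \<Longrightarrow> x < y" by (auto simp: separated_def)
  show "separated I x y \<Longrightarrow> separated I y z \<Longrightarrow> separated I x z"
    by (force simp: separated_def)
  show "separated I x y \<Longrightarrow> y < z \<Longrightarrow> separated I x z"
    by (force simp: separated_def)
  show "separated I z (Suc a) \<Longrightarrow> z < a \<Longrightarrow> a \<notin> I \<Longrightarrow> separated I z a"
    unfolding separated_def by (metis less_Suc_eq)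
qed

lemma blocking_past_first: "blocking past_first"
  by standard (auto simp: past_first_def)

section \<open>Postponing and advancing closers\<close>

definition postpone :: "(nat set \<Rightarrow> nat \<Rightarrow> nat \<Rightarrow> bool) \<Rightarrow> nat \<Rightarrow> (nat \<Rightarrow> nat) \<Rightarrow> nat \<Rightarrow> nat" where
  "postpone R n g = (\<lambda>a\<in>{1..n}.
     if \<exists>x\<in>{1..n}. R (g ` {1..n}) x a \<and> g x = g a then n else g a)"

text \<open>Undoes \<open>postpone\<close> by enforcing strict avoidance: there \<open>R x a\<close>
  and \<open>a \<le> g x\<close> must give \<open>g a \<le> g x\<close>, so \<open>a\<close> moves
  down to the least slot among its own and those of all such \<open>x\<close>. Including
  \<open>a\<close> itself keeps the set nonempty.\<close>

definition advance :: "(nat set \<Rightarrow> nat \<Rightarrow> nat \<Rightarrow> bool) \<Rightarrow> nat \<Rightarrow> (nat \<Rightarrow> nat) \<Rightarrow> nat \<Rightarrow> nat" where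
  "advance R n g = (\<lambda>a\<in>{1..n}.
     Min (g ` {x\<in>{1..n}. x = a \<or> R (g ` {1..n}) x a \<and> a \<le> g x}))"

context blocking
begin

context
  fixes n :: nat and g :: "nat \<Rightarrow> nat"
  assumes g: "g \<in> slot_maps n"
begin

private lemma bounds: "a \<in> {1..n} \<Longrightarrow> a \<le> g a \<and> g a \<le> n"
  using g by (auto simp: slot_maps_iff)

lemma advance_attained:
  assumes "a \<in> {1..n}"
  obtains x where "x \<in> {1..n}" "x = a \<or> R (g ` {1..n}) x a" "a \<le> g x" "advance R n g a = g x"
proof -
  let ?X = "{x\<in>{1..n}. x = a \<or> R (g ` {1..n}) x a \<and> a \<le> g x}"
  have "Min (g ` ?X) \<in> g ` ?X"
    using assms by (intro Min_in) auto
  then obtain x where "x \<in> ?X" "Min (g ` ?X) = g x" by auto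
  with assms bounds show thesis by (intro that[of x]) (auto simp: advance_def)
qed

lemma advance_le:
  assumes "a \<in> {1..n}" "x \<in> {1..n}" "x = a \<or> R (g ` {1..n}) x a \<and> a \<le> g x"
  shows "advance R n g a \<le> g x"
  using assms by (auto simp: advance_def intro!: Min_le)

lemma advance_slot_maps: "advance R n g \<in> slot_maps n"
  unfolding slot_maps_iff
proof (intro conjI ballI)
  show "advance R n g \<in> extensional {1..n}" by (simp add: advance_def)
next
  fix a assume a: "a \<in> {1..n}"
  then obtain x where x: "x \<in> {1..n}" "a \<le> g x" "advance R n g a = g x"
    by (rule advance_attained)
  then show "a \<le> advance R n g a" by simp
  show "advance R n g a \<le> n" using x bounds by simp
qed

lemma postpone_slot_maps: "postpone R n g \<in> slot_maps n"
  using bounds by (auto simp: slot_maps_iff postpone_def)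

text \<open>Slot \<open>n\<close> is already occupied by arc \<open>n\<close>, so postponing creates
  no new slot. None is lost either: \<open>R x a\<close> forces \<open>x < a\<close>, so the least
  arc of a fibre is not blocked and stays.\<close>

lemma postpone_image: "postpone R n g ` {1..n} = g ` {1..n}"
proof
  show "postpone R n g ` {1..n} \<subseteq> g ` {1..n}"
  proof
    fix t assume "t \<in> postpone R n g ` {1..n}"
    then obtain a where a: "a \<in> {1..n}" "t = postpone R n g a" by auto
    then have "g n = n" by (intro slot_maps_last g) auto
    with a show "t \<in> g ` {1..n}"
      by (auto simp: postpone_def image_iff Bex_def intro: exI[of _ n] split: if_splits)
  qed
next
  show "g ` {1..n} \<subseteq> postpone R n g ` {1..n}"
  proof
    fix t assume "t \<in> g ` {1..n}"
    then have ex: "\<exists>a. a \<in> {1..n} \<and> g a = t" by auto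
    define a where "a = (LEAST a. a \<in> {1..n} \<and> g a = t)"
    have a: "a \<in> {1..n}" "g a = t" using LeastI_ex[OF ex] by (auto simp: a_def)
    have "\<not> (\<exists>x\<in>{1..n}. R (g ` {1..n}) x a \<and> g x = g a)"
    proof clarify
      fix x assume x: "x \<in> {1..n}" "R (g ` {1..n}) x a" "g x = g a"
      then have "x < a" by (intro less)
      then show False using x a not_less_Least[of x "\<lambda>a. a \<in> {1..n} \<and> g a = t"] by (simp add: a_def)
    qed
    then have "postpone R n g a = t" using a by (auto simp: postpone_def)
    with a show "t \<in> postpone R n g ` {1..n}" by (metis imageI)
  qed
qed

lemma postpone_unblocked:
  assumes "a \<in> {1..n}" "postpone R n g a < n"
  shows "postpone R n g a = g a" "\<And>x. x \<in> {1..n} \<Longrightarrow> R (g ` {1..n}) x a \<Longrightarrow> g x \<noteq> g a"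
  using assms by (auto simp: postpone_def split: if_splits)

end

text \<open>Weak avoidance leaves only the arcs of slot \<open>n\<close> free to move. An arc that
  leaves slot \<open>n\<close> lands in the slot of a related arc that stays, which is exactly the
  situation that \<open>postpone\<close> detects.\<close>

lemma advance_weak_avoiders:
  assumes "g \<in> weak_avoiders R n"
  shows "advance R n g \<in> strict_avoiders R n"
    and "postpone R n (advance R n g) = g"
proof -
  let ?I = "g ` {1..n}" and ?h = "advance R n g"
  have g: "g \<in> slot_maps n" "runs_sorted n g"
    and av: "\<And>x y. x \<in> {1..n} \<Longrightarrow> y \<in> {1..n} \<Longrightarrow> R ?I x y \<Longrightarrow> y \<le> g x \<Longrightarrow> g x \<le> g y \<Longrightarrow> g y < n \<Longrightarrow> False"
    using assms unfolding weak_avoiders_def by blast+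
  have bnd: "a \<in> {1..n} \<Longrightarrow> a \<le> g a \<and> g a \<le> n" for a
    using g by (auto simp: slot_maps_iff)
  note h = advance_slot_maps[OF g(1)]
  have hbnd: "a \<in> {1..n} \<Longrightarrow> a \<le> ?h a \<and> ?h a \<le> n" for a
    using h by (auto simp: slot_maps_iff)
  \<comment> \<open>If the minimum were attained at a related \<open>x\<close> other than
    \<open>a\<close>, then \<open>a \<le> g x \<le> g a < n\<close> would make \<open>x\<close> and
    \<open>a\<close> a forbidden pair.\<close>
  have fix_lt: "?h a = g a" if a: "a \<in> {1..n}" "g a < n" for a
  proof -
    obtain x where x: "x \<in> {1..n}" "x = a \<or> R ?I x a" "a \<le> g x" "?h a = g x"
      using advance_attained[OF g(1) a(1)] .
    moreover have "?h a \<le> g a" using advance_le[OF g(1) a(1) a(1)] by simp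
    ultimately show ?thesis using av[of x a] a by auto
  qed
  have img: "?h ` {1..n} = ?I"
  proof
    show "?h ` {1..n} \<subseteq> ?I"
    proof (rule image_subsetI)
      fix a assume "a \<in> {1..n}"
      then obtain x where "x \<in> {1..n}" "?h a = g x" using advance_attained[OF g(1)] by metis
      then show "?h a \<in> ?I" by simp
    qed
    show "?I \<subseteq> ?h ` {1..n}"
    proof
      fix t assume "t \<in> ?I"
      then obtain a where a: "a \<in> {1..n}" "t = g a" by auto
      show "t \<in> ?h ` {1..n}"
      proof (cases "g a < n")
        case True
        with a fix_lt[of a] show ?thesis by force
      next
        case False
        then have "t = n" using a bnd[of a] by auto
        moreover have "?h n = n" using a by (intro slot_maps_last[OF h]) auto
        ultimately show ?thesis using a by (metis atLeastAtMost_iff imageI le_trans order_refl)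
      qed
    qed
  qed
  show "?h \<in> strict_avoiders R n"
    unfolding strict_avoiders_def mem_Collect_eq img
  proof (intro conjI)
    show "?h \<in> slot_maps n" by (rule h)
    show "runs_sorted n ?h"
      unfolding runs_sorted_def img
    proof (intro ballI impI)
      fix a assume a: "a \<in> {1..<n}" "a \<notin> ?I"
      then have in_n: "a \<in> {1..n}" "Suc a \<in> {1..n}" by auto
      have le: "g a \<le> g (Suc a)" using a g(2) by (simp add: runs_sorted_def)
      have ha: "?h a \<le> g a" using advance_le[OF g(1) in_n(1) in_n(1)] by simp
      obtain z where z: "z \<in> {1..n}" "z = Suc a \<or> R ?I z (Suc a)" "Suc a \<le> g z" "?h (Suc a) = g z"
        using advance_attained[OF g(1) in_n(2)] .
      \<comment> \<open>The slot of \<open>Suc a\<close> comes from \<open>z\<close>. If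
        \<open>z\<close> lies before \<open>a\<close>, it is also related to \<open>a\<close>, since
        \<open>a\<close> and \<open>Suc a\<close> open in the same run, and so it bounds the new
        slot of \<open>a\<close> as well.\<close>
      consider "z = Suc a" | "z = a" | "R ?I z (Suc a)" "z < a"
        using z(2) less[of ?I z "Suc a"] by force
      then show "?h a \<le> ?h (Suc a)"
      proof cases
        case 3
        then have "R ?I z a" using run_left a by blast
        then have "?h a \<le> g z" using z in_n by (intro advance_le[OF g(1)]) auto
        then show ?thesis using z by simp
      qed (use z le ha in auto)
    qed
    show "\<not> (\<exists>x\<in>{1..n}. \<exists>y\<in>{1..n}. R ?I x y \<and> y \<le> ?h x \<and> ?h x < ?h y)"
    proof clarify
      fix x y assume xy: "x \<in> {1..n}" "y \<in> {1..n}" "R ?I x y" "y \<le> ?h x" "?h x < ?h y"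
      obtain z where z: "z \<in> {1..n}" "z = x \<or> R ?I z x" "?h x = g z"
        using advance_attained[OF g(1) xy(1)] .
      \<comment> \<open>The arc \<open>z\<close> that provides the slot of \<open>x\<close> is, by
        transitivity, also a candidate for \<open>y\<close>, so \<open>y\<close> cannot get a later
        slot than \<open>x\<close>.\<close>
      then have "R ?I z y" using xy trans by blast
      then have "?h y \<le> g z" using xy z by (intro advance_le[OF g(1)]) auto
      then show False using xy z by simp
    qed
  qed
  show "postpone R n ?h = g"
  proof (rule slot_maps_eqI[OF postpone_slot_maps[OF h] g(1)])
    fix a assume a: "a \<in> {1..n}"
    show "postpone R n ?h a = g a"
    proof (cases "g a < n")
      case True
      have False if x: "x \<in> {1..n}" "R ?I x a" "?h x = ?h a" for x
      proof -
        obtain y where y: "y \<in> {1..n}" "y = x \<or> R ?I y x" "?h x = g y"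
          using advance_attained[OF g(1) x(1)] .
        then have "R ?I y a" using x trans by blast
        then show False using av[of y a] y x a True fix_lt[of a] bnd[of a] by auto
      qed
      then have "\<not> (\<exists>x\<in>{1..n}. R ?I x a \<and> ?h x = ?h a)" by blast
      then show ?thesis using a True fix_lt[of a] unfolding postpone_def img by simp
    next
      case False
      then have ga: "g a = n" using bnd[OF a] by simp
      obtain x where x: "x \<in> {1..n}" "x = a \<or> R ?I x a" "?h a = g x"
        using advance_attained[OF g(1) a] .
      show ?thesis
      proof (cases "?h a < n")
        case True
        then have "R ?I x a" "?h x = ?h a" using x ga fix_lt by auto
        then show ?thesis using a x ga unfolding postpone_def img by auto
      next
        case False
        then have "?h a = n" using hbnd[OF a] by simp
        then show ?thesis using a ga by (simp add: postpone_def)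
      qed
    qed
  qed
qed

text \<open>If a related pair with \<open>y \<le> g x \<le> g y\<close> survived below slot
  \<open>n\<close>, strict avoidance would give \<open>g x = g y\<close>, and then \<open>y\<close>
  would have been postponed.\<close>

lemma postpone_strict_avoiders:
  assumes "g \<in> strict_avoiders R n"
  shows "postpone R n g \<in> weak_avoiders R n"
    and "advance R n (postpone R n g) = g"
proof -
  let ?I = "g ` {1..n}" and ?h = "postpone R n g"
  have g: "g \<in> slot_maps n" "runs_sorted n g"
    and av: "\<And>x y. x \<in> {1..n} \<Longrightarrow> y \<in> {1..n} \<Longrightarrow> R ?I x y \<Longrightarrow> y \<le> g x \<Longrightarrow> g y \<le> g x"
    using assms unfolding strict_avoiders_def by (auto simp: not_less)
  have bnd: "a \<in> {1..n} \<Longrightarrow> a \<le> g a \<and> g a \<le> n" for a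
    using g by (auto simp: slot_maps_iff)
  note h = postpone_slot_maps[OF g(1)]
  note img = postpone_image[OF g(1)]
  note unblocked = postpone_unblocked[OF g(1)]
  have hbnd: "a \<in> {1..n} \<Longrightarrow> a \<le> ?h a \<and> ?h a \<le> n" for a
    using h by (auto simp: slot_maps_iff)
  have above: "?h a = n \<or> ?h a = g a" if "a \<in> {1..n}" for a
    using that by (auto simp: postpone_def)
  show "?h \<in> weak_avoiders R n"
    unfolding weak_avoiders_def mem_Collect_eq img
  proof (intro conjI)
    show "?h \<in> slot_maps n" by (rule h)
    show "runs_sorted n ?h"
      unfolding runs_sorted_def img
    proof (intro ballI impI)
      fix a assume a: "a \<in> {1..<n}" "a \<notin> ?I"
      then have in_n: "a \<in> {1..n}" "Suc a \<in> {1..n}" by auto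
      have le: "g a \<le> g (Suc a)" using a g(2) by (simp add: runs_sorted_def)
      \<comment> \<open>A descent requires that \<open>a\<close> is postponed and
        \<open>Suc a\<close> is not. But the arc blocking \<open>a\<close> is related to
        \<open>Suc a\<close> too, and strict avoidance together with sortedness puts
        \<open>Suc a\<close> into the same slot, so \<open>Suc a\<close> is blocked as well.\<close>
      show "?h a \<le> ?h (Suc a)"
      proof (rule ccontr)
        assume "\<not> ?thesis"
        then have lt: "?h (Suc a) < ?h a" by simp
        then have lt_n: "?h (Suc a) < n" using hbnd[OF in_n(1)] by simp
        have eq: "?h (Suc a) = g (Suc a)" using unblocked(1)[OF in_n(2) lt_n] .
        have "?h a \<noteq> g a" using lt le eq by simp
        then obtain x where x: "x \<in> {1..n}" "R ?I x a" "g x = g a"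
          using in_n by (auto simp: postpone_def split: if_splits)
        have Rx: "R ?I x (Suc a)" using mono_right[OF x(2)] by simp
        have "g a \<noteq> a" using a in_n by (metis imageI)
        then have "Suc a \<le> g x" using bnd[OF in_n(1)] x by simp
        then have "g (Suc a) \<le> g x" using av x in_n Rx by blast
        then have "g x = g (Suc a)" using x le by simp
        then show False using unblocked(2)[OF in_n(2) lt_n x(1) Rx] by simp
      qed
    qed
    show "\<not> (\<exists>x\<in>{1..n}. \<exists>y\<in>{1..n}. R ?I x y \<and> y \<le> ?h x \<and> ?h x \<le> ?h y \<and> ?h y < n)"
    proof clarify
      fix x y assume xy: "x \<in> {1..n}" "y \<in> {1..n}" "R ?I x y" "y \<le> ?h x" "?h x \<le> ?h y" "?h y < n"
      then have "?h x = g x" "?h y = g y" using unblocked(1) by auto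
      then show False using av[OF xy(1-3)] unblocked(2)[OF xy(2,6,1,3)] xy by auto
    qed
  qed
  show "advance R n ?h = g"
  proof (rule slot_maps_eqI[OF advance_slot_maps[OF h] g(1)])
    fix a assume a: "a \<in> {1..n}"
    show "advance R n ?h a = g a"
    proof (rule antisym)
      obtain x where x: "x \<in> {1..n}" "x = a \<or> R ?I x a" "a \<le> ?h x" "advance R n ?h a = ?h x"
        using advance_attained[OF h a] unfolding img .
      show "g a \<le> advance R n ?h a"
      proof (cases "x = a \<or> ?h x = n")
        case True
        then show ?thesis using x above[OF a] bnd[OF a] by auto
      next
        case False
        then show ?thesis using x above[OF x(1)] av[OF x(1) a] by simp
      qed
    next
      show "advance R n ?h a \<le> g a"
      proof (cases "?h a = g a")
        case True
        then show ?thesis using advance_le[OF h a a] by simp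
      next
        case False
        let ?P = "\<lambda>x. x \<in> {1..n} \<and> R ?I x a \<and> g x = g a"
        have ex: "\<exists>x. ?P x"
          using False a by (auto simp: postpone_def split: if_splits)
        \<comment> \<open>By transitivity the least arc blocking \<open>a\<close> is itself
          unblocked. It therefore keeps the slot \<open>g a\<close>, from which
          \<open>advance\<close> restores the value at \<open>a\<close>.\<close>
        define x where "x = (LEAST x. ?P x)"
        have x: "?P x" using LeastI_ex[OF ex] by (simp add: x_def)
        have "\<not> (\<exists>y\<in>{1..n}. R ?I y x \<and> g y = g x)"
        proof
          assume "\<exists>y\<in>{1..n}. R ?I y x \<and> g y = g x"
          then obtain y where "y \<in> {1..n}" "R ?I y x" "g y = g x" by auto
          moreover from this have "R ?I y a" using x trans by blast
          ultimately have "?P y" "y < x" using x less by simp_all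
          then show False using not_less_Least[of y ?P] by (simp add: x_def)
        qed
        then have hx: "?h x = g a" using x unfolding postpone_def by (subst restrict_apply) (simp only: if_False if_True)
        have "advance R n ?h a \<le> ?h x"
          using x hx bnd[OF a] a unfolding img[symmetric] by (intro advance_le[OF h a]) simp_all
        then show ?thesis using hx by simp
      qed
    qed
  qed
qed

lemma card_weak_avoiders: "card (weak_avoiders R n) = card (strict_avoiders R n)"
proof (rule bij_betw_same_card)
  show "bij_betw (advance R n) (weak_avoiders R n) (strict_avoiders R n)"
    by (rule bij_betw_byWitness[where f' = "postpone R n"])
      (auto simp: advance_weak_avoiders postpone_strict_avoiders)
qed

end

section \<open>Greedy maps\<close>

definition fibre_sizes :: "nat \<Rightarrow> (nat \<Rightarrow> nat) \<Rightarrow> nat \<Rightarrow> nat" where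
  "fibre_sizes n g t = card {a\<in>{1..n}. g a = t}"

text \<open>Slots are filled by open arcs in order of increasing \<open>k\<close>. The order may
  depend on the image of \<open>g\<close>, because the fibre sizes already determine that
  image.\<close>

definition greedy_maps :: "(nat set \<Rightarrow> nat \<Rightarrow> nat) \<Rightarrow> nat \<Rightarrow> (nat \<Rightarrow> nat) set" where
  "greedy_maps k n = {g \<in> slot_maps n. \<not> (\<exists>a\<in>{1..n}. \<exists>b\<in>{1..n}.
     k (g ` {1..n}) a < k (g ` {1..n}) b \<and> a \<le> g b \<and> g b < g a)}"

lemma fibre_sizes_image:
  assumes "fibre_sizes n g = fibre_sizes n h"
  shows "g ` {1..n} = h ` {1..n}"
proof -
  have "f ` {1..n} = {t. fibre_sizes n f t \<noteq> 0}" for f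
    by (auto simp: fibre_sizes_def)
  with assms show ?thesis by simp
qed

lemma fibre_sizes_swap:
  assumes "a \<in> {1..n}" "b \<in> {1..n}"
  shows "fibre_sizes n (g(a := g b, b := g a)) = fibre_sizes n g"
proof
  fix t
  let ?\<tau> = "Transposition.transpose a b"
  have "{c\<in>{1..n}. (g(a := g b, b := g a)) c = t} = ?\<tau> ` {c\<in>{1..n}. g c = t}"
  proof (rule set_eqI)
    fix c
    have "c \<in> ?\<tau> ` {c\<in>{1..n}. g c = t} \<longleftrightarrow> ?\<tau> c \<in> {c\<in>{1..n}. g c = t}"
      by (metis (no_types, lifting) image_iff transpose_involutory)
    then show "c \<in> {c\<in>{1..n}. (g(a := g b, b := g a)) c = t} \<longleftrightarrow> c \<in> ?\<tau> ` {c\<in>{1..n}. g c = t}"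
      using assms by (auto simp: Transposition.transpose_def)
  qed
  then show "fibre_sizes n (g(a := g b, b := g a)) t = fibre_sizes n g t"
    unfolding fibre_sizes_def by (simp add: card_image)
qed

text \<open>Induction over the slots: if two greedy maps agree on all earlier slots, the same arcs
  are open at slot \<open>t\<close>. Fibres of equal size that differ would contain arcs
  \<open>a\<close> and \<open>b\<close>, one closed only by \<open>g\<close> and one only by
  \<open>h\<close>; whichever of the two has smaller \<open>k\<close> is kept open wrongly by one of
  the maps.\<close>

lemma inj_fibre_sizes_greedy_maps:
  assumes inj: "\<And>I. inj_on (k I) {1..n}"
  shows "inj_on (fibre_sizes n) (greedy_maps k n)"
proof (rule inj_onI)
  fix g h assume g: "g \<in> greedy_maps k n" and h: "h \<in> greedy_maps k n"
    and eq: "fibre_sizes n g = fibre_sizes n h"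
  let ?I = "g ` {1..n}"
  have im: "h ` {1..n} = ?I" using fibre_sizes_image[OF eq] by simp
  have gs: "g \<in> slot_maps n" "h \<in> slot_maps n" using g h by (auto simp: greedy_maps_def)
  have gk: "\<not> (k ?I a < k ?I b \<and> a \<le> g b \<and> g b < g a)" if "a \<in> {1..n}" "b \<in> {1..n}" for a b
    using g that unfolding greedy_maps_def by blast
  have hk: "\<not> (k ?I a < k ?I b \<and> a \<le> h b \<and> h b < h a)" if "a \<in> {1..n}" "b \<in> {1..n}" for a b
    using h that unfolding greedy_maps_def mem_Collect_eq im by blast
  have "\<forall>a\<in>{1..n}. g a = t \<longleftrightarrow> h a = t" for t
  proof (induction t rule: less_induct)
    case (less t)
    let ?A = "{a\<in>{1..n}. g a = t}" and ?B = "{a\<in>{1..n}. h a = t}"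
    have card: "card ?A = card ?B" using fun_cong[OF eq, of t] by (simp add: fibre_sizes_def)
    have "?A = ?B"
    proof (rule ccontr)
      assume ne: "?A \<noteq> ?B"
      have "\<not> ?A \<subseteq> ?B" using card_subset_eq[of ?B ?A] card ne by auto
      moreover have "\<not> ?B \<subseteq> ?A" using card_subset_eq[of ?A ?B] card ne by auto
      ultimately obtain a b where a: "a \<in> {1..n}" "g a = t" "h a \<noteq> t"
        and b: "b \<in> {1..n}" "h b = t" "g b \<noteq> t" by auto
      have ha: "t < h a" using less.IH[of "h a"] a by (metis linorder_neqE_nat)
      have gb: "t < g b" using less.IH[of "g b"] b by (metis linorder_neqE_nat)
      have "\<forall>c\<in>{1..n}. c \<le> g c \<and> c \<le> h c" using gs by (simp add: slot_maps_iff)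
      then have "a \<le> t" "b \<le> t" using a b by (metis, metis)
      moreover have "k ?I a \<noteq> k ?I b" using inj_onD[OF inj[of ?I] _ a(1) b(1)] a b by auto
      ultimately show False
        using gk[OF b(1) a(1)] hk[OF a(1) b(1)] a b ha gb by auto
    qed
    then show ?case by blast
  qed
  then show "g = h" by (intro slot_maps_eqI[OF gs]) auto
qed

text \<open>
  Among all maps with given fibre sizes, one maximising \<open>\<Sum>a. k a * g a\<close> is greedy:
  exchanging the values of a violating pair would increase the sum.
\<close>

lemma greedy_map_exists:
  assumes f: "f \<in> slot_maps n"
  obtains g where "g \<in> greedy_maps k n" "fibre_sizes n g = fibre_sizes n f"
proof -
  define K where "K = k (f ` {1..n})"
  define X where "X = {g \<in> slot_maps n. fibre_sizes n g = fibre_sizes n f}"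
  define w where "w g = (\<Sum>a\<in>{1..n}. K a * g a)" for g :: "nat \<Rightarrow> nat"
  have X: "finite X" "X \<noteq> {}" using f finite_slot_maps by (auto simp: X_def)
  then obtain g where g: "g \<in> X" and max: "\<And>h. h \<in> X \<Longrightarrow> w h \<le> w g"
    using obtains_MAX[OF X, of w] by (metis Max_ge finite_imageI imageI)
  have im: "g ` {1..n} = f ` {1..n}" using g by (intro fibre_sizes_image) (simp add: X_def)
  have False if a: "a \<in> {1..n}" and b: "b \<in> {1..n}" and viol: "K a < K b" "a \<le> g b" "g b < g a" for a b
  proof -
    define h where "h = g(a := g b, b := g a)"
    have "a \<noteq> b" using viol by auto
    have gs: "\<forall>c\<in>{1..n}. c \<le> g c \<and> g c \<le> n" "g \<in> extensional {1..n}"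
      using g by (auto simp: X_def slot_maps_iff)
    then have "b \<le> g b" "g b \<le> n" "g a \<le> n" using a b by auto
    then have "h \<in> slot_maps n"
      using gs a b viol \<open>a \<noteq> b\<close> unfolding slot_maps_iff h_def
      by (auto simp: extensional_def)
    then have "h \<in> X" using g fibre_sizes_swap[OF a b, of g] by (simp add: X_def h_def)
    then have "w h \<le> w g" by (rule max)
    have split: "w f = K a * f a + K b * f b + (\<Sum>c\<in>{1..n} - {a} - {b}. K c * f c)" for f
      unfolding w_def using a b \<open>a \<noteq> b\<close> by (simp add: sum.remove[of _ a] sum.remove[of _ b])
    have "(\<Sum>c\<in>{1..n} - {a} - {b}. K c * h c) = (\<Sum>c\<in>{1..n} - {a} - {b}. K c * g c)"
      by (rule sum.cong) (auto simp: h_def)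
    with \<open>w h \<le> w g\<close> \<open>a \<noteq> b\<close> have "K a * g b + K b * g a \<le> K a * g a + K b * g b"
      by (simp add: split h_def)
    moreover obtain d where "0 < d" "K a + d = K b" using less_imp_add_positive[OF viol(1)] by blast
    moreover obtain e where "0 < e" "g b + e = g a" using less_imp_add_positive[OF viol(3)] by blast
    ultimately have "K a * g b + (K a + d) * (g b + e) \<le> K a * (g b + e) + (K a + d) * g b" by simp
    then have "d * e \<le> 0" by (simp add: algebra_simps)
    then show False using \<open>0 < d\<close> \<open>0 < e\<close> by simp
  qed
  then have "g \<in> greedy_maps k n"
    using g unfolding greedy_maps_def X_def K_def mem_Collect_eq im by blast
  with g show thesis by (intro that[of g]) (auto simp: X_def)
qed

text \<open>Existence and uniqueness of a greedy map for each sequence of fibre sizes make the count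
  independent of the priority order.\<close>

lemma card_greedy_maps:
  assumes "\<And>I. inj_on (k I) {1..n}"
  shows "card (greedy_maps k n) = card (fibre_sizes n ` slot_maps n)"
proof -
  have "fibre_sizes n ` greedy_maps k n = fibre_sizes n ` slot_maps n"
  proof
    show "fibre_sizes n ` greedy_maps k n \<subseteq> fibre_sizes n ` slot_maps n"
      by (auto simp: greedy_maps_def)
    show "fibre_sizes n ` slot_maps n \<subseteq> fibre_sizes n ` greedy_maps k n"
    proof (rule image_subsetI)
      fix f assume "f \<in> slot_maps n"
      then obtain g where "g \<in> greedy_maps k n" "fibre_sizes n g = fibre_sizes n f"
        by (rule greedy_map_exists)
      then show "fibre_sizes n f \<in> fibre_sizes n ` greedy_maps k n" by (metis imageI)
    qed
  qed
  then show ?thesis using card_image[OF inj_fibre_sizes_greedy_maps[of k n, OF assms]] by simp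
qed

section \<open>The greedy order for the strict avoiders of separated arcs\<close>

lemma runs_sorted_mono:
  assumes "runs_sorted n g" "1 \<le> x" "x \<le> y" "y \<le> n" "\<not> separated (g ` {1..n}) x y"
  shows "g x \<le> g y"
  using assms(3,4,5)
proof (induction y rule: dec_induct)
  case (step y)
  have "y \<notin> g ` {1..n}" "\<not> separated (g ` {1..n}) x y"
    using step by (force simp: separated_def)+
  then show ?case using step assms(1,2) unfolding runs_sorted_def by fastforce
qed simp

text \<open>Orders arcs by decreasing opening run, and by increasing opener within a run.\<close>

definition recent_first :: "nat \<Rightarrow> nat set \<Rightarrow> nat \<Rightarrow> nat" where
  "recent_first n I a = Suc n * (n - card {c\<in>I \<inter> {1..n}. c < a}) + a"

text \<open>The count \<open>N x\<close> of occupied slots below \<open>x\<close> identifies the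
  opening run of \<open>x\<close>: it is constant within a run and grows from run to run. The factor
  \<open>Suc n\<close> makes it dominate the opener, so the key compares lexicographically.\<close>

lemma recent_first_less:
  assumes "I \<subseteq> {1..n}" "a \<in> {1..n}" "b \<in> {1..n}"
  shows "recent_first n I a < recent_first n I b \<longleftrightarrow>
    (if a \<le> b then a < b \<and> \<not> separated I a b else separated I b a)"
proof -
  define N where "N x = card {c\<in>I. c < x}" for x
  have rf: "recent_first n I x = Suc n * (n - N x) + x" for x
    using assms(1) unfolding recent_first_def N_def by (simp add: Int_absorb2)
  have fin: "finite {c\<in>I. c < x}" for x by simp
  have Nn: "N x \<le> n" for x
  proof -
    have "N x \<le> card {1..n}" unfolding N_def using assms(1) by (intro card_mono) auto
    then show ?thesis by simp
  qed
  have eq: "N x = N y" if "x \<le> y" "\<not> separated I x y" for x y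
  proof -
    have "{c\<in>I. c < x} = {c\<in>I. c < y}" using that by (force simp: separated_def)
    then show ?thesis by (simp add: N_def)
  qed
  have lt: "recent_first n I y < recent_first n I x" if sep: "separated I x y" and y: "y \<in> {1..n}" for x y
  proof -
    obtain c where "c \<in> I" "x \<le> c" "c < y" using sep by (auto simp: separated_def)
    then have "{c\<in>I. c < x} \<subseteq> {c\<in>I. c < y}" "c \<in> {c\<in>I. c < y}" "c \<notin> {c\<in>I. c < x}"
      by auto
    then have "{c\<in>I. c < x} \<subset> {c\<in>I. c < y}" by blast
    then have "N x < N y" unfolding N_def by (intro psubset_card_mono fin)
    then have "Suc (n - N y) \<le> n - N x" using Nn[of y] by simp
    then have "Suc n * Suc (n - N y) \<le> Suc n * (n - N x)" by (rule mult_le_mono2)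
    moreover have "y < Suc n" using y by simp
    ultimately show ?thesis unfolding rf mult_Suc_right by linarith
  qed
  show ?thesis
  proof (cases "a \<le> b")
    case True
    then show ?thesis using lt[of a b] eq[of a b] assms rf by force
  next
    case False
    then show ?thesis using lt[of b a] eq[of b a] assms rf by force
  qed
qed

lemma inj_recent_first: "inj_on (recent_first n I) {1..n}"
proof (rule inj_onI)
  fix a b assume "a \<in> {1..n}" "b \<in> {1..n}" "recent_first n I a = recent_first n I b"
  \<comment> \<open>The opener is the residue of its key modulo \<open>Suc n\<close>.\<close>
  moreover have "recent_first n I x mod Suc n = x" if "x \<in> {1..n}" for x
    using that unfolding recent_first_def by (subst mod_mult_self4) simp
  ultimately show "a = b" by metis
qed

text \<open>A greedy violation splits by the order of the two openers. If the arc of higher priority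
  opens first, both arcs lie in one run and sortedness fails; if it opens second, the arcs are
  separated and form a strict pair.\<close>

lemma greedy_recent_first: "greedy_maps (recent_first n) n = strict_avoiders separated n"
proof (rule set_eqI)
  fix g :: "nat \<Rightarrow> nat"
  let ?I = "g ` {1..n}"
  show "g \<in> greedy_maps (recent_first n) n \<longleftrightarrow> g \<in> strict_avoiders separated n"
  proof (cases "g \<in> slot_maps n")
    case g: True
    note rf = recent_first_less[OF slot_maps_image[OF g]]
    have bnd: "a \<in> {1..n} \<Longrightarrow> a \<le> g a \<and> g a \<le> n" for a
      using g by (auto simp: slot_maps_iff)
    have "(\<exists>a\<in>{1..n}. \<exists>b\<in>{1..n}. recent_first n ?I a < recent_first n ?I b \<and> a \<le> g b \<and> g b < g a)
      \<longleftrightarrow> \<not> runs_sorted n g \<or> (\<exists>x\<in>{1..n}. \<exists>y\<in>{1..n}. separated ?I x y \<and> y \<le> g x \<and> g x < g y)"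
      (is "?L \<longleftrightarrow> ?R")
    proof
      assume ?L
      then obtain a b where ab: "a \<in> {1..n}" "b \<in> {1..n}"
        "recent_first n ?I a < recent_first n ?I b" "a \<le> g b" "g b < g a" by auto
      show ?R
      proof (cases "a \<le> b")
        case True
        then have "\<not> separated ?I a b" using ab rf by simp
        then have "\<not> runs_sorted n g" using runs_sorted_mono[of n g a b] ab True by auto
        then show ?thesis ..
      next
        case False
        then have "separated ?I b a" using ab rf by simp
        then show ?thesis using ab by blast
      qed
    next
      assume ?R
      then show ?L
      proof
        assume "\<not> runs_sorted n g"
        then obtain a where a: "a \<in> {1..<n}" "a \<notin> ?I" "g (Suc a) < g a"
          by (auto simp: runs_sorted_def not_le)
        then have "\<not> separated ?I a (Suc a)" by (auto simp: separated_def less_Suc_eq_le dest: antisym)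
        then show ?L using a rf[of a "Suc a"] bnd[of "Suc a"]
          by (intro bexI[of _ a] bexI[of _ "Suc a"]) auto
      next
        assume "\<exists>x\<in>{1..n}. \<exists>y\<in>{1..n}. separated ?I x y \<and> y \<le> g x \<and> g x < g y"
        then obtain x y where xy: "x \<in> {1..n}" "y \<in> {1..n}" "separated ?I x y" "y \<le> g x" "g x < g y"
          by auto
        then have "x < y" by (auto simp: separated_def)
        then show ?L using xy rf[of y x] by (intro bexI[of _ y] bexI[of _ x]) auto
      qed
    qed
    then show ?thesis using g unfolding greedy_maps_def strict_avoiders_def by blast
  qed (auto simp: greedy_maps_def strict_avoiders_def)
qed

section \<open>Monotone maps and Catalan numbers\<close>

text \<open>These maps are ballot paths in disguise. The upper bound \<open>m\<close> is kept apart
  from \<open>n\<close> so that a recursion in both parameters is available.\<close>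

definition bounded_monotone :: "nat \<Rightarrow> nat \<Rightarrow> (nat \<Rightarrow> nat) set" where
  "bounded_monotone n m = {g \<in> (\<Pi>\<^sub>E a\<in>{1..n}. {a..m}). mono_on {1..n} g}"

lemma finite_bounded_monotone: "finite (bounded_monotone n m)"
proof -
  have "finite (\<Pi>\<^sub>E a\<in>{1..n}. {a..m})" by (intro finite_PiE) auto
  then show ?thesis by (auto simp: bounded_monotone_def)
qed

text \<open>For \<open>a < b\<close> the condition \<open>a \<le> g b\<close> follows from
  \<open>b \<le> g b\<close>, so the greedy violations for the opener order are exactly the
  descents.\<close>

lemma greedy_monotone: "greedy_maps (\<lambda>_ a. a) n = bounded_monotone n n"
proof (rule set_eqI)
  fix g :: "nat \<Rightarrow> nat"
  show "g \<in> greedy_maps (\<lambda>_ a. a) n \<longleftrightarrow> g \<in> bounded_monotone n n"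
  proof (cases "g \<in> slot_maps n")
    case True
    then have "\<forall>a\<in>{1..n}. a \<le> g a" by (auto simp: slot_maps_iff)
    then have "a \<le> g b \<longleftrightarrow> True" if "b \<in> {1..n}" "a < b" for a b
      using that by (auto dest!: bspec[of _ _ b])
    moreover have "mono_on {1..n} g \<longleftrightarrow> \<not> (\<exists>a\<in>{1..n}. \<exists>b\<in>{1..n}. a < b \<and> g b < g a)"
      unfolding monotone_on_def by (metis le_less linorder_not_le)
    ultimately have "(\<exists>a\<in>{1..n}. \<exists>b\<in>{1..n}. a < b \<and> a \<le> g b \<and> g b < g a) \<longleftrightarrow> \<not> mono_on {1..n} g"
      by blast
    with True show ?thesis 
      unfolding greedy_maps_def bounded_monotone_def slot_maps_def mem_Collect_eq by blast
  qed (auto simp: greedy_maps_def bounded_monotone_def slot_maps_def)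
qed

lemma bounded_monotone_0: "bounded_monotone 0 m = {\<lambda>_. undefined}"
  by (auto simp: bounded_monotone_def monotone_on_def)

lemma bounded_monotone_empty: "bounded_monotone (Suc n) n = {}"
  by (auto simp: bounded_monotone_def PiE_def Pi_def)

text \<open>The two terms count the maps with last value at most \<open>m\<close> and equal to \<open>Suc m\<close>.\<close>

lemma card_bounded_monotone_Suc:
  assumes "n \<le> m"
  shows "card (bounded_monotone (Suc n) (Suc m)) =
    card (bounded_monotone (Suc n) m) + card (bounded_monotone n (Suc m))"
proof -
  let ?X = "bounded_monotone (Suc n) (Suc m)"
  let ?ext = "\<lambda>g. g(Suc n := Suc m)"
  have split: "?X = {g\<in>?X. g (Suc n) \<le> m} \<union> {g\<in>?X. g (Suc n) = Suc m}"
    by (auto simp: bounded_monotone_def PiE_def Pi_def)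
  have low: "{g\<in>?X. g (Suc n) \<le> m} = bounded_monotone (Suc n) m"
  proof (intro set_eqI iffI)
    fix g assume "g \<in> {g\<in>?X. g (Suc n) \<le> m}"
    then have g: "g \<in> ?X" "g (Suc n) \<le> m" by auto
    then have "g a \<le> m" if "a \<in> {1..Suc n}" for a
      using that unfolding bounded_monotone_def monotone_on_def by fastforce
    then show "g \<in> bounded_monotone (Suc n) m" using g by (auto simp: bounded_monotone_def PiE_def Pi_def)
  qed (force simp: bounded_monotone_def PiE_def Pi_def)
  have "bij_betw ?ext (bounded_monotone n (Suc m)) {g\<in>?X. g (Suc n) = Suc m}"
  proof (rule bij_betw_byWitness[where f' = "\<lambda>g. g(Suc n := undefined)"])
    show "\<forall>g\<in>bounded_monotone n (Suc m). (?ext g)(Suc n := undefined) = g"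
      by (auto simp: bounded_monotone_def PiE_def extensional_def fun_eq_iff)
    show "?ext ` bounded_monotone n (Suc m) \<subseteq> {g\<in>?X. g (Suc n) = Suc m}"
      using assms by (auto simp: bounded_monotone_def monotone_on_def PiE_def Pi_def extensional_def le_Suc_eq)
    show "(\<lambda>g. g(Suc n := undefined)) ` {g\<in>?X. g (Suc n) = Suc m} \<subseteq> bounded_monotone n (Suc m)"
      by (auto simp: bounded_monotone_def monotone_on_def PiE_def Pi_def extensional_def)
  qed auto
  then have "card {g\<in>?X. g (Suc n) = Suc m} = card (bounded_monotone n (Suc m))"
    by (simp add: bij_betw_same_card)
  moreover have "card ?X = card {g\<in>?X. g (Suc n) \<le> m} + card {g\<in>?X. g (Suc n) = Suc m}"
    using finite_bounded_monotone[of "Suc n" "Suc m"] by (subst split, subst card_Un_disjoint) auto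
  ultimately show ?thesis by (simp add: low)
qed

text \<open>The ballot numbers, by a double induction along the recursion. Admitting
  \<open>n = Suc m\<close>, where both sides vanish, supplies the boundary values;
  \<open>n = m\<close> yields the Catalan number.\<close>

lemma card_bounded_monotone:
  "n \<le> Suc m \<Longrightarrow> (real m + 1) * card (bounded_monotone n m) = (real m + 1 - real n) * ((n + m) choose n)"
proof (induction n arbitrary: m)
  case 0
  then show ?case by (simp add: bounded_monotone_0)
next
  case (Suc n)
  note IHn = Suc.IH
  show ?case using Suc.prems
  proof (induction m)
    case 0
    then show ?case by (simp add: bounded_monotone_empty)
  next
    case (Suc m)
    show ?case
    proof (cases "n \<le> m")
      case False
      then have "n = Suc m" using Suc.prems by simp
      then show ?thesis by (simp add: bounded_monotone_empty)
    next
      case True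
      define x where "x = real (card (bounded_monotone (Suc n) m))"
      define y where "y = real (card (bounded_monotone n (Suc m)))"
      define b where "b = real ((n + Suc m) choose n)"
      define c where "c = real ((n + Suc m) choose Suc n)"
      have x: "(real m + 1) * x = (real m - real n) * c"
        using Suc.IH True by (simp add: x_def c_def)
      have y: "(real m + 2) * y = (real m + 2 - real n) * b"
        using IHn[of "Suc m"] True by (simp add: y_def b_def add.commute)
      \<comment> \<open>Absorption links the two neighbouring binomial coefficients \<open>b\<close>
        and \<open>c\<close>, so that the summands of the recursion can be combined.\<close>
      have "Suc n * ((n + Suc m) choose Suc n) = (n + Suc m - n) * ((n + Suc m) choose n)"
        by (metis binomial_absorption binomial_absorb_comp)
      then have bc: "(real n + 1) * c = (real m + 1) * b"
        unfolding b_def c_def by (metis (no_types, lifting) diff_add_inverse of_nat_Suc of_nat_mult add.commute)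
      have "(real m + 2) * (x + y) = (real m + 1 - real n) * (b + c)"
      proof -
        \<comment> \<open>The factor \<open>real m + 1\<close> clears the denominator in the formula
          for \<open>x\<close>; it is positive and is cancelled at the end.\<close>
        have "(real m + 1) * ((real m + 2) * (x + y)) =
          (real m + 2) * ((real m + 1) * x) + (real m + 1) * ((real m + 2) * y)"
          by (simp add: algebra_simps)
        also have "\<dots> = (real m + 2) * (real m - real n) * c + (real m + 2 - real n) * ((real m + 1) * b)"
          unfolding x y by simp
        also have "\<dots> = (real m + 1 - real n) * ((real m + 1) * c + (real m + 1) * b)"
          unfolding bc[symmetric] by (simp add: algebra_simps)
        also have "\<dots> = (real m + 1) * ((real m + 1 - real n) * (b + c))"
          by (simp add: algebra_simps)
        finally show ?thesis by (simp add: add_nonneg_eq_0_iff)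
      qed
      \<comment> \<open>By Pascal's rule \<open>b + c\<close> is the binomial coefficient of the
        claim.\<close>
      then show ?thesis
        using card_bounded_monotone_Suc[OF True] by (simp add: x_def y_def b_def c_def algebra_simps)
    qed
  qed
qed

section \<open>Ranks and pattern containment\<close>

lemma strict_mono_on_comp:
  assumes "strict_mono_on A f" "strict_mono_on B h" "f ` A \<subseteq> B"
  shows "strict_mono_on A (h \<circ> f)"
proof (rule strict_mono_onI)
  fix x y assume "x \<in> A" "y \<in> A" "x < y"
  then have "f x < f y" "f x \<in> B" "f y \<in> B" using strict_mono_onD[OF assms(1)] assms(3) by auto
  then show "(h \<circ> f) x < (h \<circ> f) y" using strict_mono_onD[OF assms(2)] by simp
qed

definition rank :: "nat set \<Rightarrow> nat \<Rightarrow> nat" where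
  "rank X x = card {y\<in>X. y \<le> x}"

lemma relabel_rank: "relabel N = (\<lambda>A. rank (\<Union>N) ` A) ` N"
  by (simp add: relabel_def rank_def)

lemma rank_strict_mono:
  assumes "finite X" shows "strict_mono_on X (rank X)"
proof (rule strict_mono_onI)
  fix x y assume "x \<in> X" "y \<in> X" "x < y"
  then have "{z\<in>X. z \<le> x} \<subset> {z\<in>X. z \<le> y}" by force
  then show "rank X x < rank X y"
    unfolding rank_def using assms by (intro psubset_card_mono) auto
qed

lemma rank_less_iff: "finite X \<Longrightarrow> x \<in> X \<Longrightarrow> y \<in> X \<Longrightarrow> rank X x < rank X y \<longleftrightarrow> x < y"
  using rank_strict_mono strict_mono_on_less by blast

lemma inj_rank: "finite X \<Longrightarrow> inj_on (rank X) X"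
  using rank_strict_mono strict_mono_on_imp_inj_on by blast

lemma rank_image:
  assumes "finite X" shows "rank X ` X = {1..card X}"
proof (rule card_subset_eq)
  show "rank X ` X \<subseteq> {1..card X}"
  proof
    fix r assume "r \<in> rank X ` X"
    then obtain x where x: "x \<in> X" "r = rank X x" by auto
    have "rank X x \<le> card X" unfolding rank_def using assms by (intro card_mono) auto
    moreover have "rank X x > 0" unfolding rank_def using assms x by (auto simp: card_gt_0_iff)
    ultimately show "r \<in> {1..card X}" using x by auto
  qed
  show "card (rank X ` X) = card {1..card X}" using card_image[OF inj_rank[OF assms]] by simp
qed simp

text \<open>Types I and II speak of adjacent labels; this translates adjacency back to the endpoints
  before relabelling.\<close>

lemma rank_Suc_iff:
  assumes X: "finite X" "u \<in> X" "v \<in> X"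
  shows "rank X v = Suc (rank X u) \<longleftrightarrow> u < v \<and> (\<forall>w\<in>X. \<not> (u < w \<and> w < v))"
proof
  assume eq: "rank X v = Suc (rank X u)"
  then have "u < v" using rank_less_iff[OF X] by simp
  moreover have False if "w \<in> X" "u < w" "w < v" for w
    using that eq rank_less_iff[OF X(1), of u w] rank_less_iff[OF X(1), of w v] X by simp
  ultimately show "u < v \<and> (\<forall>w\<in>X. \<not> (u < w \<and> w < v))" by blast
next
  assume "u < v \<and> (\<forall>w\<in>X. \<not> (u < w \<and> w < v))"
  then have "{y\<in>X. y \<le> v} = insert v {y\<in>X. y \<le> u}" "\<not> v \<le> u" using X by force+
  then show "rank X v = Suc (rank X u)" using X by (simp add: rank_def)
qed

lemma rank_strict_mono_image:
  fixes e :: "nat \<Rightarrow> nat"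
  assumes e: "strict_mono_on {1..m} e" and i: "i \<in> {1..m}"
  shows "rank (e ` {1..m}) (e i) = i"
proof -
  have "{y \<in> e ` {1..m}. y \<le> e i} = e ` {1..i}"
    using i strict_mono_on_less_eq[OF e _ i] by (auto simp: image_iff)
  moreover have "inj_on e {1..i}"
    using i by (intro inj_on_subset[OF strict_mono_on_imp_inj_on[OF e]]) auto
  ultimately show ?thesis by (simp add: rank_def card_image)
qed

lemma relabel_strict_mono_image:
  assumes "strict_mono_on {1..m} e" "\<Union>P = {1..m}"
  shows "relabel ((\<lambda>A. e ` A) ` P) = P"
proof -
  have "\<Union>((\<lambda>A. e ` A) ` P) = e ` {1..m}" using assms(2) by blast
  moreover have "rank (e ` {1..m}) ` e ` A = A" if "A \<in> P" for A
  proof -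
    have "A \<subseteq> {1..m}" using that assms(2) by blast
    then have "rank (e ` {1..m}) (e i) = i" if "i \<in> A" for i
      using that rank_strict_mono_image[OF assms(1)] by blast
    then show ?thesis by (force simp: image_iff)
  qed
  ultimately show ?thesis unfolding relabel_rank by (force simp: image_iff)
qed

lemma relabel_inverse:
  assumes fin: "finite (\<Union>N)"
  obtains e where "strict_mono_on {1..card (\<Union>N)} e" "(\<lambda>A. e ` A) ` relabel N = N"
    "e ` {1..card (\<Union>N)} = \<Union>N"
proof -
  let ?X = "\<Union>N"
  define e where "e = inv_into ?X (rank ?X)"
  have inv: "e (rank ?X x) = x" if "x \<in> ?X" for x
    unfolding e_def using inj_rank[OF fin] that by (rule inv_into_f_f)
  have "strict_mono_on {1..card ?X} e"
    unfolding rank_image[OF fin, symmetric]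
  proof (rule strict_mono_onI)
    fix r s assume "r \<in> rank ?X ` ?X" "s \<in> rank ?X ` ?X" "r < s"
    then obtain x y where "x \<in> ?X" "y \<in> ?X" "r = rank ?X x" "s = rank ?X y" by blast
    with \<open>r < s\<close> show "e r < e s" using rank_less_iff[OF fin] inv by metis
  qed
  moreover have "e ` rank ?X ` A = A" if "A \<in> N" for A
    using that inv by (force simp: image_iff)
  then have "(\<lambda>A. e ` A) ` relabel N = N"
    unfolding relabel_rank by (force simp: image_iff)
  moreover have "e ` {1..card ?X} = ?X"
    unfolding rank_image[OF fin, symmetric] using inv by (force simp: image_iff)
  ultimately show thesis by (rule that)
qed

lemma Union_relabel: "finite (\<Union>N) \<Longrightarrow> \<Union>(relabel N) = {1..card (\<Union>N)}"
  by (subst rank_image[symmetric]) (auto simp: relabel_rank)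

text \<open>An occurrence amounts to an increasing embedding of the positions of the pattern: the
  ranking of the chosen endpoints has an increasing inverse, and ranking an increasing image
  restores the pattern.\<close>

lemma contains_pattern_iff:
  assumes fin: "finite (\<Union>M)" and P: "\<Union>P = {1..m}"
  shows "contains_pattern M P \<longleftrightarrow> (\<exists>e. strict_mono_on {1..m} e \<and> (\<lambda>A. e ` A) ` P \<subseteq> M)"
proof
  assume "contains_pattern M P"
  then obtain N where N: "N \<subseteq> M" "relabel N = P" by (auto simp: contains_pattern_def)
  then have finN: "finite (\<Union>N)" using fin by (meson Union_mono finite_subset)
  have "{1..m} = {1..card (\<Union>N)}" using Union_relabel[OF finN] unfolding N(2) P .
  from arg_cong[OF this, of card] have "card (\<Union>N) = m" by simp
  with relabel_inverse[OF finN] N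
  show "\<exists>e. strict_mono_on {1..m} e \<and> (\<lambda>A. e ` A) ` P \<subseteq> M" by metis
next
  assume "\<exists>e. strict_mono_on {1..m} e \<and> (\<lambda>A. e ` A) ` P \<subseteq> M"
  then show "contains_pattern M P"
    unfolding contains_pattern_def using relabel_strict_mono_image[OF _ P] by blast
qed

text \<open>Embeddings are composed with the ranking or with its inverse. Patterns can thus be
  sought among the keys of a matching instead of its labels.\<close>

lemma contains_pattern_relabel:
  assumes fin: "finite (\<Union>N)" and P: "\<Union>P = {1..m}"
  shows "contains_pattern (relabel N) P \<longleftrightarrow> contains_pattern N P"
proof -
  let ?X = "\<Union>N"
  have finr: "finite (\<Union>(relabel N))" using Union_relabel[OF fin] by simp
  obtain d where d: "strict_mono_on {1..card ?X} d" "(\<lambda>A. d ` A) ` relabel N = N"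
    "d ` {1..card ?X} = ?X" using relabel_inverse[OF fin] .
  show ?thesis
    unfolding contains_pattern_iff[OF fin P] contains_pattern_iff[OF finr P]
  proof
    assume "\<exists>e. strict_mono_on {1..m} e \<and> (\<lambda>A. e ` A) ` P \<subseteq> relabel N"
    then obtain e where e: "strict_mono_on {1..m} e" "(\<lambda>A. e ` A) ` P \<subseteq> relabel N" by auto
    have "e ` {1..m} \<subseteq> {1..card ?X}"
      using e(2) P Union_relabel[OF fin] by (metis Union_mono image_Union)
    then have "strict_mono_on {1..m} (d \<circ> e)"
      by (rule strict_mono_on_comp[OF e(1) d(1)])
    moreover have "(\<lambda>A. (d \<circ> e) ` A) ` P \<subseteq> N"
    proof (rule image_subsetI)
      fix A assume "A \<in> P"
      then have "d ` e ` A \<in> (\<lambda>A. d ` A) ` relabel N" using e(2) by blast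
      then show "(d \<circ> e) ` A \<in> N" unfolding d(2) by (simp add: image_comp)
    qed
    ultimately show "\<exists>e. strict_mono_on {1..m} e \<and> (\<lambda>A. e ` A) ` P \<subseteq> N" by blast
  next
    assume "\<exists>e. strict_mono_on {1..m} e \<and> (\<lambda>A. e ` A) ` P \<subseteq> N"
    then obtain e where e: "strict_mono_on {1..m} e" "(\<lambda>A. e ` A) ` P \<subseteq> N" by auto
    have "e ` {1..m} \<subseteq> ?X" using e(2) P by (metis Union_mono image_Union)
    then have "strict_mono_on {1..m} (rank ?X \<circ> e)"
      by (rule strict_mono_on_comp[OF e(1) rank_strict_mono[OF fin]])
    moreover have "(\<lambda>A. (rank ?X \<circ> e) ` A) ` P \<subseteq> relabel N"
    proof (rule image_subsetI)
      fix A assume "A \<in> P"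
      then have "rank ?X ` e ` A \<in> relabel N" using e(2) unfolding relabel_rank by blast
      then show "(rank ?X \<circ> e) ` A \<in> relabel N" by (simp add: image_comp)
    qed
    ultimately show "\<exists>e. strict_mono_on {1..m} e \<and> (\<lambda>A. e ` A) ` P \<subseteq> relabel N" by blast
  qed
qed

section \<open>Encoding matchings\<close>

text \<open>
  The event \<open>a * Suc n + b\<close> is the opener of arc \<open>a\<close> if \<open>b = 0\<close>, and the closer of arc \<open>b\<close> in slot
  \<open>a\<close> otherwise; the order of these keys is the order of the endpoints.
\<close>

definition opener_key :: "nat \<Rightarrow> nat \<Rightarrow> nat" where
  "opener_key n a = a * Suc n"

definition closer_key :: "nat \<Rightarrow> (nat \<Rightarrow> nat) \<Rightarrow> nat \<Rightarrow> nat" where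
  "closer_key n g a = g a * Suc n + a"

definition keyed_arcs :: "nat \<Rightarrow> (nat \<Rightarrow> nat) \<Rightarrow> nat set set" where
  "keyed_arcs n g = (\<lambda>a. {opener_key n a, closer_key n g a}) ` {1..n}"

definition decode :: "nat \<Rightarrow> (nat \<Rightarrow> nat) \<Rightarrow> nat set set" where
  "decode n g = relabel (keyed_arcs n g)"

lemma lex_less_iff:
  fixes p q r s :: nat
  assumes "r \<le> n" "s \<le> n"
  shows "p * Suc n + r < q * Suc n + s \<longleftrightarrow> p < q \<or> p = q \<and> r < s"
proof -
  have lt: "p * Suc n + r < q * Suc n + s" if "p < q" "r \<le> n" for p q r s
  proof -
    have "Suc p * Suc n \<le> q * Suc n" using that by (intro mult_le_mono1) simp
    then show ?thesis using that by simp
  qed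
  show ?thesis using lt[of p q r s] lt[of q p s r] assms by (cases p q rule: linorder_cases) auto
qed

context
  fixes n :: nat and g :: "nat \<Rightarrow> nat"
  assumes g: "g \<in> slot_maps n"
begin

private abbreviation "opener \<equiv> opener_key n"
private abbreviation "closer \<equiv> closer_key n g"
private definition X :: "nat set" where "X = opener ` {1..n} \<union> closer ` {1..n}"

private lemma bounds: "a \<in> {1..n} \<Longrightarrow> a \<le> g a \<and> g a \<le> n"
  using g by (auto simp: slot_maps_iff)

text \<open>An opener has offset \<open>0\<close> and hence precedes every closer of its own slot;
  this makes the mixed comparisons \<open>b \<le> g a\<close> and \<open>g a < b\<close>.\<close>

lemma key_less:
  assumes "a \<in> {1..n}" "b \<in> {1..n}"
  shows "opener a < opener b \<longleftrightarrow> a < b" "opener b < closer a \<longleftrightarrow> b \<le> g a"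
    "closer a < opener b \<longleftrightarrow> g a < b" "closer a < closer b \<longleftrightarrow> g a < g b \<or> g a = g b \<and> a < b"
  using assms lex_less_iff[of 0 n 0 a b] lex_less_iff[of 0 n a b "g a"]
    lex_less_iff[of a n 0 "g a" b] lex_less_iff[of a n b "g a" "g b"]
  by (auto simp: opener_key_def closer_key_def)

private lemma Union_keyed: "\<Union>(keyed_arcs n g) = X"
  by (auto simp: keyed_arcs_def X_def)

private lemma finite_X: "finite X" by (simp add: X_def)

private lemma mem_X: "a \<in> {1..n} \<Longrightarrow> opener a \<in> X" "a \<in> {1..n} \<Longrightarrow> closer a \<in> X"
  by (auto simp: X_def)

private lemma opener_less_closer: "a \<in> {1..n} \<Longrightarrow> opener a < closer a"
  using key_less(2) bounds by blast

private lemma inj_keys: "inj_on opener {1..n}" "inj_on closer {1..n}"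
    "opener ` {1..n} \<inter> closer ` {1..n} = {}"
proof -
  show "inj_on opener {1..n}"
    using key_less(1) by (intro inj_onI) (metis nat_neq_iff)
  show "inj_on closer {1..n}"
    using key_less(4) by (intro inj_onI) (metis nat_neq_iff)
  have "opener b \<noteq> closer a" if "a \<in> {1..n}" "b \<in> {1..n}" for a b
    using key_less(2,3)[OF that] by (metis leI less_irrefl)
  then show "opener ` {1..n} \<inter> closer ` {1..n} = {}" by auto
qed

private lemma card_X: "card X = 2 * n"
  using inj_keys unfolding X_def by (simp add: card_Un_disjoint card_image)

lemma keyed_arcs_less_iff:
  "u < v \<and> {u, v} \<in> keyed_arcs n g \<longleftrightarrow> (\<exists>a\<in>{1..n}. u = opener a \<and> v = closer a)"
  using opener_less_closer by (fastforce simp: keyed_arcs_def doubleton_eq_iff)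

lemma matching_decode: "matching n (decode n g)"
proof -
  have disj: "disjnt {opener a, closer a} {opener b, closer b}"
    if "a \<in> {1..n}" "b \<in> {1..n}" "a \<noteq> b" for a b
  proof -
    have "opener a \<noteq> opener b" "closer a \<noteq> closer b"
      using that inj_onD[OF inj_keys(1)] inj_onD[OF inj_keys(2)] by blast+
    moreover have "opener a \<noteq> closer b" "opener b \<noteq> closer a"
      using that inj_keys(3) by blast+
    ultimately show ?thesis by (simp add: disjnt_def)
  qed
  have "partition_on X (keyed_arcs n g)"
  proof (rule partition_onI)
    fix p q assume "p \<in> keyed_arcs n g" "q \<in> keyed_arcs n g" "p \<noteq> q"
    then show "disjnt p q" using disj unfolding keyed_arcs_def by blast
  qed (use Union_keyed in \<open>auto simp: keyed_arcs_def\<close>)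
  then have "partition_on (rank X ` X) ((`) (rank X) ` keyed_arcs n g - {{}})"
    by (rule partition_on_inj_image) (rule inj_rank[OF finite_X])
  moreover have "(`) (rank X) ` keyed_arcs n g - {{}} = decode n g"
    unfolding decode_def relabel_rank Union_keyed by (auto simp: keyed_arcs_def)
  ultimately have "partition_on {1..2 * n} (decode n g)"
    by (simp add: rank_image[OF finite_X] card_X)
  moreover have "card A = 2" if "A \<in> decode n g" for A
  proof -
    from that obtain a where a: "a \<in> {1..n}" "A = rank X ` {opener a, closer a}"
      unfolding decode_def relabel_rank Union_keyed by (auto simp: keyed_arcs_def)
    then have "rank X (opener a) < rank X (closer a)"
      using rank_less_iff[OF finite_X] mem_X opener_less_closer by blast
    with a show ?thesis by simp
  qed
  ultimately show ?thesis by (simp add: matching_def)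
qed

private lemma is_arc_decode:
  "is_arc (decode n g) x y \<longleftrightarrow> (\<exists>a\<in>{1..n}. x = rank X (opener a) \<and> y = rank X (closer a))"
proof -
  have "rank X (opener a) < rank X (closer a)" if "a \<in> {1..n}" for a
    using that rank_less_iff[OF finite_X] mem_X opener_less_closer by blast
  then show ?thesis
    unfolding is_arc_def decode_def relabel_rank Union_keyed
    by (fastforce simp: keyed_arcs_def doubleton_eq_iff image_iff)
qed

text \<open>Adjacent closers share a slot, since otherwise the opener of arc
  \<open>Suc (g b)\<close> would lie between them, and within a slot the closers follow the order of
  their openers.\<close>

lemma not_type_II_decode: "\<not> type_II (decode n g)"
proof
  assume "type_II (decode n g)"
  then obtain j k l where arcs: "is_arc (decode n g) k (j + 1)" "is_arc (decode n g) l j"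
    and kl: "k < l" unfolding type_II_def by blast
  then obtain a b where a: "a \<in> {1..n}" "k = rank X (opener a)" "j + 1 = rank X (closer a)"
    and b: "b \<in> {1..n}" "l = rank X (opener b)" "j = rank X (closer b)"
    unfolding is_arc_decode by blast
  have "a < b" using a b kl rank_less_iff[OF finite_X] mem_X key_less(1) by metis
  have "rank X (closer a) = Suc (rank X (closer b))" using a b by simp
  then have lt: "closer b < closer a" and none: "\<And>w. w \<in> X \<Longrightarrow> \<not> (closer b < w \<and> w < closer a)"
    using rank_Suc_iff[OF finite_X] mem_X a b by blast+
  have "g b < g a" using lt key_less(4)[OF b(1) a(1)] \<open>a < b\<close> by auto
  then have "Suc (g b) \<in> {1..n}" "Suc (g b) \<le> g a" using bounds[OF a(1)] by auto
  then show False using none[OF mem_X(1)] key_less a(1) b(1) by blast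
qed

text \<open>Adjacent openers belong to consecutive arcs \<open>a\<close> and \<open>Suc a\<close>,
  and no closer lies between these exactly when \<open>a\<close> is not a value of \<open>g\<close>.
  Nesting of the two arcs then means \<open>g (Suc a) < g a\<close>.\<close>

lemma type_I_decode: "type_I (decode n g) \<longleftrightarrow> \<not> runs_sorted n g"
proof
  assume "type_I (decode n g)"
  then obtain i k l where arcs: "is_arc (decode n g) i l" "is_arc (decode n g) (i + 1) k"
    and kl: "k < l" unfolding type_I_def by blast
  then obtain a b where a: "a \<in> {1..n}" "i = rank X (opener a)" "l = rank X (closer a)"
    and b: "b \<in> {1..n}" "i + 1 = rank X (opener b)" "k = rank X (closer b)"
    unfolding is_arc_decode by blast
  have "rank X (opener b) = Suc (rank X (opener a))" using a b by simp
  then have lt: "opener a < opener b" and none: "\<And>w. w \<in> X \<Longrightarrow> \<not> (opener a < w \<and> w < opener b)"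
    using rank_Suc_iff[OF finite_X] mem_X a b by blast+
  have "a < b" using lt key_less(1) a b by blast
  then have ba: "b = Suc a"
    using none[OF mem_X(1), of "Suc a"] key_less(1) a b by fastforce
  have "a \<notin> g ` {1..n}"
  proof
    assume "a \<in> g ` {1..n}"
    then obtain w where "w \<in> {1..n}" "g w = a" by auto
    then show False using none[OF mem_X(2), of w] key_less a b ba by auto
  qed
  moreover have "closer b < closer a" using kl a b rank_less_iff[OF finite_X] mem_X by metis
  then have "g b < g a" using key_less(4)[OF b(1) a(1)] \<open>a < b\<close> by auto
  ultimately show "\<not> runs_sorted n g" using a b ba unfolding runs_sorted_def by force
next
  assume "\<not> runs_sorted n g"
  then obtain a where a: "a \<in> {1..<n}" "a \<notin> g ` {1..n}" "g (Suc a) < g a"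
    by (auto simp: runs_sorted_def not_le)
  then have in_n: "a \<in> {1..n}" "Suc a \<in> {1..n}" by auto
  have "\<not> (opener a < w \<and> w < opener (Suc a))" if "w \<in> X" for w
    using that unfolding X_def
  proof
    assume "w \<in> opener ` {1..n}"
    then show ?thesis using key_less(1) in_n by auto
  next
    assume "w \<in> closer ` {1..n}"
    then obtain c where c: "c \<in> {1..n}" "w = closer c" by auto
    then have "g c \<noteq> a" using a by auto
    then show ?thesis using c key_less(2)[OF c(1) in_n(1)] key_less(3)[OF c(1) in_n(2)] by auto
  qed
  then have adj: "rank X (opener (Suc a)) = rank X (opener a) + 1"
    using rank_Suc_iff[OF finite_X mem_X(1) mem_X(1), OF in_n] key_less(1)[OF in_n] by simp
  have "rank X (closer (Suc a)) < rank X (closer a)"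
    using rank_less_iff[OF finite_X] mem_X in_n key_less(4)[OF in_n(2,1)] a by auto
  moreover have "rank X (opener (Suc a)) < rank X (closer (Suc a))"
    using rank_less_iff[OF finite_X] mem_X in_n opener_less_closer by blast
  moreover have "is_arc (decode n g) (rank X (opener a)) (rank X (closer a))"
    "is_arc (decode n g) (rank X (opener (Suc a))) (rank X (closer (Suc a)))"
    unfolding is_arc_decode using in_n by blast+
  ultimately show "type_I (decode n g)" unfolding type_I_def adj by metis
qed

text \<open>Counting the openers up to an endpoint of the decoded matching recovers the number of an
  arc and its slot, so \<open>g\<close> can be read off from the matching alone.\<close>

private lemma index_decode:
  defines "idx \<equiv> rank {x. \<exists>y. is_arc (decode n g) x y}"
  assumes a: "a \<in> {1..n}"
  shows "idx (rank X (opener a)) = a" "idx (rank X (closer a)) = g a"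
proof -
  have O: "{x. \<exists>y. is_arc (decode n g) x y} = rank X ` opener ` {1..n}"
    unfolding is_arc_decode by auto
  have idx: "idx (rank X k) = card {a\<in>{1..n}. opener a \<le> k}" if "k \<in> X" for k
  proof -
    have "{z \<in> rank X ` opener ` {1..n}. z \<le> rank X k} = (rank X \<circ> opener) ` {a\<in>{1..n}. opener a \<le> k}"
      using that rank_less_iff[OF finite_X] mem_X by (fastforce simp: not_less[symmetric])
    moreover have "inj_on (rank X \<circ> opener) {a\<in>{1..n}. opener a \<le> k}"
      by (intro comp_inj_on inj_on_subset[OF inj_keys(1)] inj_on_subset[OF inj_rank[OF finite_X]])
        (auto simp: mem_X)
    ultimately show ?thesis unfolding idx_def O rank_def[of "_ ` _"] by (simp only: card_image)
  qed
  have "{b\<in>{1..n}. opener b \<le> opener a} = {1..a}"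
    using key_less(1) a by (auto simp: not_less[symmetric])
  then show "idx (rank X (opener a)) = a" using idx[OF mem_X(1)[OF a]] by simp
  have "{b\<in>{1..n}. opener b \<le> closer a} = {1..g a}"
    using key_less(3)[OF a] bounds[OF a] by (auto simp: not_less[symmetric])
  then show "idx (rank X (closer a)) = g a" using idx[OF mem_X(2)[OF a]] by simp
qed

lemma decode_arc_index:
  assumes "is_arc (decode n g) x y"
  defines "idx \<equiv> rank {x. \<exists>y. is_arc (decode n g) x y}"
  shows "idx y = g (idx x)"
  using assms(1) index_decode unfolding is_arc_decode[of x y] idx_def by auto

lemma decode_arc_with_index:
  assumes "a \<in> {1..n}"
  obtains x y where "is_arc (decode n g) x y" "rank {x. \<exists>y. is_arc (decode n g) x y} x = a"
  using assms index_decode(1)[OF assms] is_arc_decode by blast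

lemma contains_pattern_decode:
  assumes "\<Union>P = {1..m}"
  shows "contains_pattern (decode n g) P \<longleftrightarrow> contains_pattern (keyed_arcs n g) P"
  unfolding decode_def by (rule contains_pattern_relabel[OF _ assms]) (simp add: Union_keyed finite_X)

lemma finite_Union_keyed_arcs: "finite (\<Union>(keyed_arcs n g))"
  unfolding Union_keyed by (rule finite_X)

end

section \<open>Recovering the map from the matching\<close>

lemma inj_decode: "inj_on (decode n) (slot_maps n)"
proof (rule inj_onI)
  fix g h assume g: "g \<in> slot_maps n" and h: "h \<in> slot_maps n" and eq: "decode n g = decode n h"
  show "g = h"
  proof (rule slot_maps_eqI[OF g h])
    fix a assume "a \<in> {1..n}"
    then obtain x y where "is_arc (decode n g) x y" "rank {x. \<exists>y. is_arc (decode n g) x y} x = a"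
      by (rule decode_arc_with_index[OF g])
    then show "g a = h a"
      using decode_arc_index[OF g, of x y] decode_arc_index[OF h, of x y] eq by simp
  qed
qed

lemma strict_mono_on_consecutive:
  fixes f :: "nat \<Rightarrow> nat"
  assumes "\<And>i. i \<in> {1..<m} \<Longrightarrow> f i < f (Suc i)"
  shows "strict_mono_on {1..m} f"
proof (rule strict_mono_onI)
  fix r s assume "r \<in> {1..m}" "s \<in> {1..m}" "r < s"
  from \<open>r < s\<close> have "Suc r \<le> s" by simp
  then have "s \<le> m \<longrightarrow> f r < f s"
  proof (induction s rule: dec_induct)
    case base
    show ?case using assms[of r] \<open>r \<in> {1..m}\<close> by simp
  next
    case (step s)
    then show ?case using assms[of s] \<open>r \<in> {1..m}\<close> by fastforce
  qed
  then show "f r < f s" using \<open>s \<in> {1..m}\<close> by simp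
qed

lemma matching_block:
  assumes "matching n M" "A \<in> M"
  obtains a b where "A = {a, b}" "is_arc M a b" "1 \<le> a" "b \<le> 2 * n"
proof -
  from assms have "card A = 2" "A \<subseteq> {1..2 * n}" by (auto simp: matching_def partition_on_def)
  then obtain x y where "A = {x, y}" "x < y" by (metis card_2_iff insert_commute linorder_neqE_nat)
  with \<open>A \<subseteq> _\<close> assms(2) show thesis by (intro that[of x y]) (auto simp: is_arc_def)
qed

lemma matching_unique:
  assumes "matching n M" "A \<in> M" "B \<in> M" "x \<in> A" "x \<in> B"
  shows "A = B"
  using assms unfolding matching_def by (meson disjoint_iff partition_on_def disjointD)

lemma matching_arcs_eq:
  assumes "matching n M" "is_arc M a b" "is_arc M c d" "{a, b} \<inter> {c, d} \<noteq> {}"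
  shows "a = c \<and> b = d"
proof -
  have "{a, b} = {c, d}" using assms matching_unique[OF assms(1)] by (auto simp: is_arc_def)
  then show ?thesis using assms by (auto simp: is_arc_def doubleton_eq_iff)
qed

text \<open>Arcs are numbered by the rank of their openers, and \<open>g\<close> counts the openers
  up to each closer. The function \<open>key\<close> sends every endpoint to the key of its event;
  it is increasing because type II is absent, so relabelling the keyed arcs gives back
  \<open>M\<close>.\<close>

lemma surj_decode:
  assumes M: "matching n M" "\<not> type_II M"
  obtains g where "g \<in> slot_maps n" "decode n g = M"
proof -
  define op where "op = {x. \<exists>y. is_arc M x y}"
  define idx where "idx = rank op"
  note arcs_eq = matching_arcs_eq[OF M(1)]
  have UM: "\<Union>M = {1..2 * n}" using M by (simp add: matching_def partition_on_def)
  have op_sub: "op \<subseteq> {1..2 * n}" using UM by (auto simp: op_def is_arc_def)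
  then have fin: "finite op" by (rule finite_subset) simp
  define opn where "opn y = (THE x. is_arc M x y)" for y
  have opn: "opn y = x" if "is_arc M x y" for x y
    unfolding opn_def using that arcs_eq by (intro the_equality) auto
  have opn_arc: "is_arc M (opn y) y" if "y \<in> {1..2 * n}" "y \<notin> op" for y
  proof -
    from that(1) obtain A where "A \<in> M" "y \<in> A" using UM by blast
    then obtain a b where ab: "y \<in> {a, b}" "is_arc M a b" using matching_block[OF M(1)] by metis
    then have "y \<noteq> a" using that(2) by (auto simp: op_def)
    then have "is_arc M (opn b) b" "y = b" using ab opn by simp_all
    then show ?thesis by simp
  qed
  define clo where "clo x = (THE y. is_arc M x y)" for x
  have clo: "clo x = y" if "is_arc M x y" for x y
    unfolding clo_def using that arcs_eq by (intro the_equality) auto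
  have clo_arc: "is_arc M x (clo x)" if "x \<in> op" for x
    using that clo by (auto simp: op_def)
  have arc_op: "x \<in> op" "y \<notin> op" if "is_arc M x y" for x y
  proof -
    show "x \<in> op" using that by (auto simp: op_def)
    have False if "is_arc M y z" for z
      using arcs_eq[OF \<open>is_arc M x y\<close> that] \<open>is_arc M x y\<close> by (auto simp: is_arc_def)
    then show "y \<notin> op" by (auto simp: op_def)
  qed
  have card_op: "card op = n"
  proof -
    have "op \<union> clo ` op = {1..2 * n}"
    proof
      show "op \<union> clo ` op \<subseteq> {1..2 * n}" using op_sub clo_arc UM by (auto simp: is_arc_def)
      show "{1..2 * n} \<subseteq> op \<union> clo ` op"
      proof
        fix y assume y: "y \<in> {1..2 * n}"
        show "y \<in> op \<union> clo ` op"
        proof (cases "y \<in> op")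
          case False
          then have arc: "is_arc M (opn y) y" using opn_arc y by blast
          then have "opn y \<in> op" "y = clo (opn y)" using arc_op(1) clo by auto
          then show ?thesis by blast
        qed simp
      qed
    qed
    moreover have "op \<inter> clo ` op = {}" using clo_arc arc_op by blast
    moreover have "inj_on clo op" using clo_arc opn by (intro inj_onI) metis
    ultimately have "card op + card op = 2 * n"
      using fin card_Un_disjoint[of op "clo ` op"] by (simp add: card_image)
    then show ?thesis by simp
  qed
  have idx_image: "idx ` op = {1..n}" using rank_image[OF fin] card_op by (simp add: idx_def)
  have idx_le: "idx x \<le> n" for x
    unfolding idx_def rank_def card_op[symmetric] using fin by (intro card_mono) auto
  have idx_mono: "idx x \<le> idx y" if "x \<le> y" for x y
    unfolding idx_def rank_def using fin that by (intro card_mono) auto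
  have idx_Suc: "idx (Suc x) = (if Suc x \<in> op then Suc (idx x) else idx x)" for x
  proof -
    have "{y \<in> op. y \<le> Suc x} = (if Suc x \<in> op then insert (Suc x) {y\<in>op. y \<le> x} else {y\<in>op. y \<le> x})"
      by (auto simp: le_Suc_eq)
    then show ?thesis using fin by (simp add: idx_def rank_def)
  qed
  define g where "g = (\<lambda>a\<in>{1..n}. idx (clo (inv_into op idx a)))"
  have g: "g (idx x) = idx (clo x)" "idx x \<in> {1..n}" if "x \<in> op" for x
    using that idx_image inj_rank[OF fin] by (auto simp: g_def idx_def inv_into_f_f)
  define key where "key x = (if x \<in> op then idx x * Suc n else idx x * Suc n + idx (opn x))" for x
  have "key x < key (Suc x)" if x: "x \<in> {1..<2 * n}" for x
  proof (cases "Suc x \<in> op")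
    case True
    \<comment> \<open>Keys of both kinds stay in the block belonging to \<open>idx x\<close>, and a
      new opener starts the next block.\<close>
    have "key x \<le> idx x * Suc n + n" using idx_le by (auto simp: key_def)
    then show ?thesis using True by (simp add: key_def idx_Suc)
  next
    case False
    have arc: "is_arc M (opn (Suc x)) (Suc x)" using opn_arc False x by simp
    then have "opn (Suc x) \<in> op" by (rule arc_op)
    \<comment> \<open>Arc numbers start at \<open>1\<close>, so a closer right after an opener gets
      a strictly larger key in the same block.\<close>
    then have pos: "0 < idx (opn (Suc x))" using g(2) by force
    show ?thesis
    proof (cases "x \<in> op")
      case True
      then show ?thesis using False pos by (simp add: key_def idx_Suc)
    next
      case x_op: False
      then have arc': "is_arc M (opn x) x" using opn_arc x by simp
      have "opn x \<noteq> opn (Suc x)" using arcs_eq[OF arc arc'] by auto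
      \<comment> \<open>Adjacent closers whose openers come in the opposite order would form a type
        II pair.\<close>
      moreover have "\<not> opn (Suc x) < opn x"
        using M(2) arc arc' unfolding type_II_def by (metis Suc_eq_plus1 is_arc_def)
      ultimately have "opn x < opn (Suc x)" by simp
      then have "idx (opn x) < idx (opn (Suc x))"
        unfolding idx_def using rank_less_iff[OF fin] arc_op arc arc' by blast
      then show ?thesis using False x_op by (simp add: key_def idx_Suc)
    qed
  qed
  then have mono: "strict_mono_on {1..2 * n} key" by (rule strict_mono_on_consecutive)
  have block: "key ` {x, y} = {opener_key n (idx x), closer_key n g (idx x)}" if "is_arc M x y" for x y
    using that arc_op[OF that] opn[OF that] clo[OF that] g(1)[of x] 
    by (simp add: key_def opener_key_def closer_key_def insert_commute)
  have "(\<lambda>A. key ` A) ` M = keyed_arcs n g"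
  proof
    show "(\<lambda>A. key ` A) ` M \<subseteq> keyed_arcs n g"
    proof (rule image_subsetI)
      fix A assume "A \<in> M"
      then obtain x y where xy: "A = {x, y}" "is_arc M x y" using matching_block[OF M(1)] by metis
      then have "idx x \<in> {1..n}" using g(2) arc_op by blast
      then show "key ` A \<in> keyed_arcs n g" unfolding xy(1) block[OF xy(2)] keyed_arcs_def by blast
    qed
    show "keyed_arcs n g \<subseteq> (\<lambda>A. key ` A) ` M"
    proof
      fix B assume "B \<in> keyed_arcs n g"
      then obtain a where a: "a \<in> {1..n}" "B = {opener_key n a, closer_key n g a}" by (auto simp: keyed_arcs_def)
      then obtain x where x: "x \<in> op" "a = idx x" using idx_image by (metis imageE)
      then have "is_arc M x (clo x)" by (intro clo_arc)
      then have "{x, clo x} \<in> M" "B = key ` {x, clo x}" using block a x by (auto simp: is_arc_def)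
      then show "B \<in> (\<lambda>A. key ` A) ` M" by blast
    qed
  qed
  then have "decode n g = M"
    unfolding decode_def using relabel_strict_mono_image[OF mono UM] by simp
  moreover have "g \<in> slot_maps n"
    unfolding slot_maps_iff
  proof (intro conjI ballI)
    show "g \<in> extensional {1..n}" by (simp add: g_def)
  next
    fix a assume "a \<in> {1..n}"
    then obtain x where x: "x \<in> op" "a = idx x" using idx_image by (metis imageE)
    then have "x \<le> clo x" using clo_arc by (force simp: is_arc_def)
    then show "a \<le> g a" "g a \<le> n" using x g idx_mono idx_le by auto
  qed
  ultimately show thesis by (intro that)
qed

lemma decode_bij_betw:
  "bij_betw (decode n) {g \<in> slot_maps n. runs_sorted n g} (stoimenow_matchings n)"
proof (rule bij_betw_imageI)
  show "inj_on (decode n) {g \<in> slot_maps n. runs_sorted n g}"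
    by (rule inj_on_subset[OF inj_decode]) auto
  show "decode n ` {g \<in> slot_maps n. runs_sorted n g} = stoimenow_matchings n"
  proof
    show "decode n ` {g \<in> slot_maps n. runs_sorted n g} \<subseteq> stoimenow_matchings n"
      using matching_decode type_I_decode not_type_II_decode by (auto simp: stoimenow_matchings_def)
    show "stoimenow_matchings n \<subseteq> decode n ` {g \<in> slot_maps n. runs_sorted n g}"
    proof
      fix M assume M: "M \<in> stoimenow_matchings n"
      then obtain g where "g \<in> slot_maps n" "decode n g = M"
        using surj_decode by (auto simp: stoimenow_matchings_def)
      then show "M \<in> decode n ` {g \<in> slot_maps n. runs_sorted n g}"
        using M type_I_decode[of g n] by (auto simp: stoimenow_matchings_def)
    qed
  qed
qed

section \<open>The five patterns\<close>

lemma atLeastAtMost_8: "{1..8::nat} = {1, 2, 3, 4, 5, 6, 7, 8}"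
  by auto

lemma strict_mono_on_8_iff:
  fixes e :: "nat \<Rightarrow> nat"
  shows "strict_mono_on {1..8} e \<longleftrightarrow>
    e 1 < e 2 \<and> e 2 < e 3 \<and> e 3 < e 4 \<and> e 4 < e 5 \<and> e 5 < e 6 \<and> e 6 < e 7 \<and> e 7 < e 8"
    (is "_ \<longleftrightarrow> ?R")
proof
  assume e: "strict_mono_on {1..8} e"
  show ?R by (intro conjI strict_mono_onD[OF e]) simp_all
next
  assume R: ?R
  show "strict_mono_on {1..8} e"
  proof (rule strict_mono_on_consecutive)
    fix i :: nat assume "i \<in> {1..<8}"
    then have "i \<in> {1, 2, 3, 4, 5, 6, 7}" by auto
    then show "e i < e (Suc i)" using R by (elim insertE emptyE) (simp_all del: One_nat_def)
  qed
qed

lemma Union_P: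
  "\<Union>P1 = {1..8}" "\<Union>P2 = {1..8}" "\<Union>P3 = {1..8}" "\<Union>P4 = {1..8}" "\<Union>P5 = {1..8}"
  unfolding atLeastAtMost_8 P1_def P2_def P3_def P4_def P5_def by auto

text \<open>The order of closers in the decoded matching: within a common slot the earlier opener
  closes first.\<close>

definition closes_before :: "(nat \<Rightarrow> nat) \<Rightarrow> nat \<Rightarrow> nat \<Rightarrow> bool" where
  "closes_before g a b \<longleftrightarrow> g a < g b \<or> g a = g b \<and> a < b"

context
  fixes n :: nat and g :: "nat \<Rightarrow> nat"
  assumes g: "g \<in> slot_maps n"
begin

private lemma key_cmp:
  assumes "a \<in> {1..n}" "b \<in> {1..n}"
  shows "opener_key n a < opener_key n b \<longleftrightarrow> a < b" "opener_key n b < closer_key n g a \<longleftrightarrow> b \<le> g a"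
    "closer_key n g a < opener_key n b \<longleftrightarrow> g a < b"
    "closer_key n g a < closer_key n g b \<longleftrightarrow> closes_before g a b"
  using key_less[OF g assms] by (simp_all add: closes_before_def)

text \<open>An embedding of a pattern with four arcs is a choice of four arcs of the matching, whose
  keys are written at the positions of the pattern. The default \<open>0\<close> is overwritten at
  all of \<open>1\<close> to \<open>8\<close>, and monotonicity then unfolds to seven
  comparisons.\<close>

private lemma four_arcs:
  assumes U: "\<Union>P = {1..8}" and P: "P = {{p1, q1}, {p2, q2}, {p3, q3}, {p4, q4}}"
    and less: "p1 < q1" "p2 < q2" "p3 < q3" "p4 < q4"
    and dist: "distinct [p1, q1, p2, q2, p3, q3, p4, q4]"
  shows "contains_pattern (decode n g) P \<longleftrightarrow>
    (\<exists>w\<in>{1..n}. \<exists>x\<in>{1..n}. \<exists>y\<in>{1..n}. \<exists>z\<in>{1..n}. strict_mono_on {1..8} ((\<lambda>_. 0)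
      (p1 := opener_key n w, q1 := closer_key n g w, p2 := opener_key n x, q2 := closer_key n g x,
       p3 := opener_key n y, q3 := closer_key n g y, p4 := opener_key n z, q4 := closer_key n g z)))"
    (is "_ \<longleftrightarrow> (\<exists>w\<in>_. \<exists>x\<in>_. \<exists>y\<in>_. \<exists>z\<in>_. strict_mono_on _ (?e w x y z))")
  unfolding contains_pattern_decode[OF g U] contains_pattern_iff[OF finite_Union_keyed_arcs[OF g] U]
proof
  assume "\<exists>e. strict_mono_on {1..8} e \<and> (\<lambda>A. e ` A) ` P \<subseteq> keyed_arcs n g"
  then obtain e where e: "strict_mono_on {1..8} e" "(\<lambda>A. e ` A) ` P \<subseteq> keyed_arcs n g" by auto
  have sub: "{p1, q1, p2, q2, p3, q3, p4, q4} = {1..8}" using U unfolding P by auto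
  then have in8: "p1 \<in> {1..8}" "q1 \<in> {1..8}" "p2 \<in> {1..8}" "q2 \<in> {1..8}"
    "p3 \<in> {1..8}" "q3 \<in> {1..8}" "p4 \<in> {1..8}" "q4 \<in> {1..8}" by blast+
  have arc: "\<exists>a\<in>{1..n}. e p = opener_key n a \<and> e q = closer_key n g a"
    if "{p, q} \<in> P" "p \<in> {1..8}" "q \<in> {1..8}" "p < q" for p q
  proof -
    have "e ` {p, q} \<in> keyed_arcs n g" using e(2) that(1) by blast
    then have "{e p, e q} \<in> keyed_arcs n g" by simp
    moreover have "e p < e q" using strict_mono_onD[OF e(1)] that by blast
    ultimately show ?thesis using keyed_arcs_less_iff[OF g] by blast
  qed
  obtain w where w: "w \<in> {1..n}" "e p1 = opener_key n w" "e q1 = closer_key n g w"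
    using arc[of p1 q1] in8 less P by auto
  obtain x where x: "x \<in> {1..n}" "e p2 = opener_key n x" "e q2 = closer_key n g x"
    using arc[of p2 q2] in8 less P by auto
  obtain y where y: "y \<in> {1..n}" "e p3 = opener_key n y" "e q3 = closer_key n g y"
    using arc[of p3 q3] in8 less P by auto
  obtain z where z: "z \<in> {1..n}" "e p4 = opener_key n z" "e q4 = closer_key n g z"
    using arc[of p4 q4] in8 less P by auto
  have "?e w x y z i = e i" if "i \<in> {1..8}" for i
    using that w x y z dist unfolding sub[symmetric] by auto
  then have "strict_mono_on {1..8} (?e w x y z)"
    using e(1) by (simp add: monotone_on_def)
  then show "\<exists>w\<in>{1..n}. \<exists>x\<in>{1..n}. \<exists>y\<in>{1..n}. \<exists>z\<in>{1..n}. strict_mono_on {1..8} (?e w x y z)"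
    using w(1) x(1) y(1) z(1) by blast
next
  assume "\<exists>w\<in>{1..n}. \<exists>x\<in>{1..n}. \<exists>y\<in>{1..n}. \<exists>z\<in>{1..n}. strict_mono_on {1..8} (?e w x y z)"
  then obtain w x y z where m: "w \<in> {1..n}" "x \<in> {1..n}" "y \<in> {1..n}" "z \<in> {1..n}"
    and e: "strict_mono_on {1..8} (?e w x y z)" by blast
  have "(\<lambda>A. ?e w x y z ` A) ` P \<subseteq> keyed_arcs n g"
    using dist m unfolding P keyed_arcs_def by auto
  with e show "\<exists>e. strict_mono_on {1..8} e \<and> (\<lambda>A. e ` A) ` P \<subseteq> keyed_arcs n g" by blast
qed

lemma contains_P1_decode:
  "contains_pattern (decode n g) P1 \<longleftrightarrow> (\<exists>w\<in>{1..n}. \<exists>x\<in>{1..n}. \<exists>y\<in>{1..n}. \<exists>z\<in>{1..n}.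
     w < x \<and> x \<le> g w \<and> g w < y \<and> y \<le> g y \<and> g y < z \<and> z \<le> g x \<and> closes_before g x z)"
  by (subst four_arcs[OF Union_P(1) P1_def]; (intro bex_cong refl)?; simp add: strict_mono_on_8_iff key_cmp del: One_nat_def)

lemma contains_P2_decode:
  "contains_pattern (decode n g) P2 \<longleftrightarrow> (\<exists>w\<in>{1..n}. \<exists>x\<in>{1..n}. \<exists>y\<in>{1..n}. \<exists>z\<in>{1..n}.
     w < x \<and> x \<le> g w \<and> g w < y \<and> y \<le> g x \<and> g x < z \<and> z \<le> g y \<and> closes_before g y z)"
  by (subst four_arcs[OF Union_P(2) P2_def]; (intro bex_cong refl)?; simp add: strict_mono_on_8_iff key_cmp del: One_nat_def)

lemma contains_P3_decode:
  "contains_pattern (decode n g) P3 \<longleftrightarrow> (\<exists>w\<in>{1..n}. \<exists>x\<in>{1..n}. \<exists>y\<in>{1..n}. \<exists>z\<in>{1..n}.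
     w \<le> g w \<and> g w < x \<and> x < y \<and> y \<le> g x \<and> closes_before g x y \<and> g y < z \<and> z \<le> g z)"
  by (subst four_arcs[OF Union_P(3) P3_def]; (intro bex_cong refl)?; simp add: strict_mono_on_8_iff key_cmp del: One_nat_def)

lemma contains_P4_decode:
  "contains_pattern (decode n g) P4 \<longleftrightarrow> (\<exists>w\<in>{1..n}. \<exists>x\<in>{1..n}. \<exists>y\<in>{1..n}. \<exists>z\<in>{1..n}.
     w \<le> g w \<and> g w < x \<and> x < y \<and> y \<le> g x \<and> g x < z \<and> z \<le> g y \<and> closes_before g y z)"
  by (subst four_arcs[OF Union_P(4) P4_def]; (intro bex_cong refl)?; simp add: strict_mono_on_8_iff key_cmp del: One_nat_def)

lemma contains_P5_decode:
  "contains_pattern (decode n g) P5 \<longleftrightarrow> (\<exists>w\<in>{1..n}. \<exists>x\<in>{1..n}. \<exists>y\<in>{1..n}. \<exists>z\<in>{1..n}.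
     w < x \<and> x \<le> g w \<and> g w < y \<and> y \<le> g x \<and> closes_before g x y \<and> g y < z \<and> z \<le> g z)"
  by (subst four_arcs[OF Union_P(5) P5_def]; (intro bex_cong refl)?; simp add: strict_mono_on_8_iff key_cmp del: One_nat_def)

end

text \<open>Supplies the first arc of \<open>P1\<close>, \<open>P2\<close> and \<open>P5\<close>.
  Let \<open>w\<close> close in the first occupied slot \<open>c\<close> from \<open>x\<close> on.
  Were \<open>w\<close> to open at or after \<open>x\<close>, it would lie in the run of
  \<open>x\<close>, and sortedness would give \<open>g x \<le> g w < y\<close>, contrary to
  \<open>y \<le> g x\<close>.\<close>

lemma crossing_from_left:
  assumes "runs_sorted n g" "x \<in> {1..n}" "y \<in> {1..n}"
    and sep: "separated (g ` {1..n}) x y" and "y \<le> g x" and g: "g \<in> slot_maps n"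
  obtains w where "w \<in> {1..n}" "w < x" "x \<le> g w" "g w < y"
proof -
  let ?P = "\<lambda>c. c \<in> g ` {1..n} \<and> x \<le> c \<and> c < y"
  define c where "c = (LEAST c. ?P c)"
  have "\<exists>c. ?P c" using sep by (auto simp: separated_def)
  then have c: "?P c" unfolding c_def by (rule LeastI_ex)
  have none: "\<not> ?P d" if "d < c" for d using not_less_Least that unfolding c_def .
  obtain w where w: "w \<in> {1..n}" "g w = c" using c by auto
  have "w \<le> c" using w g by (auto simp: slot_maps_iff)
  have "w < x"
  proof (rule ccontr)
    assume "\<not> w < x"
    then have "x \<le> w" by simp
    have "\<not> separated (g ` {1..n}) x w"
      using none \<open>w \<le> c\<close> c unfolding separated_def by (metis less_le_trans less_trans)
    then have "g x \<le> g w" using runs_sorted_mono[of n g x w] assms(1,2) w(1) \<open>x \<le> w\<close> by auto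
    then show False using w c assms(5) by simp
  qed
  with w c show thesis by (intro that[of w]) auto
qed

text \<open>A descent \<open>g y < g x\<close> with \<open>x < y\<close> nests \<open>y\<close>
  inside \<open>x\<close>. Sortedness puts the two arcs into different runs, so an arc crosses
  \<open>x\<close> from the left, and a fourth arc crossing \<open>x\<close> on the right completes
  \<open>P1\<close>.\<close>

lemma avoid_P1: "{g \<in> slot_maps n. runs_sorted n g \<and> \<not> contains_pattern (decode n g) P1} = bounded_monotone n n"
proof (intro set_eqI iffI)
  fix g assume "g \<in> {g \<in> slot_maps n. runs_sorted n g \<and> \<not> contains_pattern (decode n g) P1}"
  then have g: "g \<in> slot_maps n" "runs_sorted n g" and av: "\<not> contains_pattern (decode n g) P1" by auto
  have bnd: "a \<in> {1..n} \<Longrightarrow> a \<le> g a \<and> g a \<le> n" for a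
    using g(1) by (auto simp: slot_maps_iff)
  have "g x \<le> g y" if xy: "x \<in> {1..n}" "y \<in> {1..n}" "x \<le> y" for x y
  proof (rule ccontr)
    assume "\<not> g x \<le> g y"
    then have lt: "g y < g x" by simp
    then have "separated (g ` {1..n}) x y" using runs_sorted_mono[OF g(2), of x y] xy by auto
    moreover have "y \<le> g x" using bnd[OF xy(2)] lt by simp
    ultimately obtain w where w: "w \<in> {1..n}" "w < x" "x \<le> g w" "g w < y"
      using crossing_from_left g xy by metis
    \<comment> \<open>The arc numbered \<open>g x\<close> is the last to open before
      \<open>x\<close> closes; it opens after the closer of \<open>y\<close> and closes after
      \<open>x\<close>.\<close>
    have z: "g x \<in> {1..n}" using bnd[OF xy(1)] xy by simp
    have "x < y" using xy lt by (metis le_neq_implies_less less_irrefl)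
    then have "closes_before g x (g x)"
      using bnd[OF z] bnd[OF xy(2)] lt by (auto simp: closes_before_def)
    then show False
      using av w xy z lt bnd[OF xy(2)] unfolding contains_P1_decode[OF g(1)] by blast
  qed
  then have "mono_on {1..n} g" by (simp add: monotone_on_def)
  then show "g \<in> bounded_monotone n n" using g by (simp add: bounded_monotone_def slot_maps_def)
next
  fix g assume "g \<in> bounded_monotone n n"
  then have g: "g \<in> slot_maps n" and mono: "mono_on {1..n} g"
    by (simp_all add: bounded_monotone_def slot_maps_def)
  have le: "g x \<le> g y" if "x \<in> {1..n}" "y \<in> {1..n}" "x \<le> y" for x y
    using mono that by (simp add: monotone_on_def)
  have "runs_sorted n g" using le by (simp add: runs_sorted_def)
  moreover have "\<not> contains_pattern (decode n g) P1"
  proof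
    assume "contains_pattern (decode n g) P1"
    then obtain w x y z where m: "x \<in> {1..n}" "y \<in> {1..n}"
      and c: "x \<le> g w" "g w < y" "g y < z" "z \<le> g x"
      unfolding contains_P1_decode[OF g] by blast
    then show False using le[OF m] by simp
  qed
  ultimately show "g \<in> {g \<in> slot_maps n. runs_sorted n g \<and> \<not> contains_pattern (decode n g) P1}"
    using g by simp
qed

context
  fixes n :: nat and g :: "nat \<Rightarrow> nat"
  assumes g: "g \<in> slot_maps n" and sorted: "runs_sorted n g"
begin

private lemma bnd: "a \<in> {1..n} \<Longrightarrow> a \<le> g a \<and> g a \<le> n"
  using g by (auto simp: slot_maps_iff)

text \<open>The arc numbered \<open>g y\<close> is the last to open before \<open>y\<close> closes;
  it serves as the fourth arc of \<open>P2\<close> and \<open>P4\<close>.\<close>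

private lemma slot_arc:
  assumes "x \<in> {1..n}" "y \<in> {1..n}" "x < y" "y \<le> g x" "g x < g y"
  shows "g y \<in> {1..n}" "closes_before g y (g y)"
proof -
  show z: "g y \<in> {1..n}" using bnd[OF assms(2)] assms(2) by simp
  show "closes_before g y (g y)" using bnd[OF z] assms by (auto simp: closes_before_def)
qed

text \<open>Here \<open>x\<close> and \<open>y\<close> are the two middle arcs of the pattern. The
  outer ones can be supplied: the first by \<open>crossing_from_left\<close>, the fourth as arc
  \<open>g y\<close>.\<close>

lemma contains_P2_iff:
  "contains_pattern (decode n g) P2 \<longleftrightarrow>
    (\<exists>x\<in>{1..n}. \<exists>y\<in>{1..n}. separated (g ` {1..n}) x y \<and> y \<le> g x \<and> g x < g y)"
  unfolding contains_P2_decode[OF g]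
proof safe
  fix w x y z assume "w \<in> {1..n}" "x \<in> {1..n}" "y \<in> {1..n}"
    "x \<le> g w" "g w < y" "y \<le> g x" "g x < z" "z \<le> g y"
  then show "\<exists>x\<in>{1..n}. \<exists>y\<in>{1..n}. separated (g ` {1..n}) x y \<and> y \<le> g x \<and> g x < g y"
    by (intro bexI[of _ x] bexI[of _ y]) (auto simp: separated_def)
next
  fix x y assume xy: "x \<in> {1..n}" "y \<in> {1..n}" "separated (g ` {1..n}) x y" "y \<le> g x" "g x < g y"
  then obtain w where w: "w \<in> {1..n}" "w < x" "x \<le> g w" "g w < y"
    using crossing_from_left g sorted by metis
  have "x < y" using w by simp
  from slot_arc[OF xy(1,2) this xy(4,5)] w xy
  show "\<exists>w\<in>{1..n}. \<exists>x\<in>{1..n}. \<exists>y\<in>{1..n}. \<exists>z\<in>{1..n}.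
     w < x \<and> x \<le> g w \<and> g w < y \<and> y \<le> g x \<and> g x < z \<and> z \<le> g y \<and> closes_before g y z"
    by blast
qed

text \<open>The first arc is one that closes in an occupied slot below \<open>x\<close>; the last is
  arc \<open>n\<close>, which opens after \<open>y\<close> closes because
  \<open>g y < n\<close>.\<close>

lemma contains_P3_iff:
  "contains_pattern (decode n g) P3 \<longleftrightarrow>
    (\<exists>x\<in>{1..n}. \<exists>y\<in>{1..n}. past_first (g ` {1..n}) x y \<and> y \<le> g x \<and> g x \<le> g y \<and> g y < n)"
  unfolding contains_P3_decode[OF g]
proof safe
  fix w x y z assume "w \<in> {1..n}" "x \<in> {1..n}" "y \<in> {1..n}" "z \<in> {1..n}"
    "g w < x" "x < y" "y \<le> g x" "closes_before g x y" "g y < z"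
  then show "\<exists>x\<in>{1..n}. \<exists>y\<in>{1..n}. past_first (g ` {1..n}) x y \<and> y \<le> g x \<and> g x \<le> g y \<and> g y < n"
    by (intro bexI[of _ x] bexI[of _ y]) (auto simp: past_first_def closes_before_def)
next
  fix x y assume xy: "x \<in> {1..n}" "y \<in> {1..n}" "past_first (g ` {1..n}) x y" "y \<le> g x" "g x \<le> g y" "g y < n"
  then obtain w where w: "w \<in> {1..n}" "g w < x" "x < y" by (auto simp: past_first_def)
  have "w \<le> g w" "closes_before g x y" "n \<in> {1..n}" "n \<le> g n"
    using w xy bnd[of w] bnd[of n] by (auto simp: closes_before_def)
  then show "\<exists>w\<in>{1..n}. \<exists>x\<in>{1..n}. \<exists>y\<in>{1..n}. \<exists>z\<in>{1..n}.
     w \<le> g w \<and> g w < x \<and> x < y \<and> y \<le> g x \<and> closes_before g x y \<and> g y < z \<and> z \<le> g z"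
    using w xy by blast
qed

lemma contains_P4_iff:
  "contains_pattern (decode n g) P4 \<longleftrightarrow>
    (\<exists>x\<in>{1..n}. \<exists>y\<in>{1..n}. past_first (g ` {1..n}) x y \<and> y \<le> g x \<and> g x < g y)"
  unfolding contains_P4_decode[OF g]
proof safe
  fix w x y z assume "w \<in> {1..n}" "x \<in> {1..n}" "y \<in> {1..n}"
    "g w < x" "x < y" "y \<le> g x" "g x < z" "z \<le> g y"
  then show "\<exists>x\<in>{1..n}. \<exists>y\<in>{1..n}. past_first (g ` {1..n}) x y \<and> y \<le> g x \<and> g x < g y"
    by (intro bexI[of _ x] bexI[of _ y]) (auto simp: past_first_def)
next
  fix x y assume xy: "x \<in> {1..n}" "y \<in> {1..n}" "past_first (g ` {1..n}) x y" "y \<le> g x" "g x < g y"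
  then obtain w where w: "w \<in> {1..n}" "g w < x" "x < y" by (auto simp: past_first_def)
  from slot_arc[OF xy(1,2) w(3) xy(4,5)] bnd[OF w(1)] w xy
  show "\<exists>w\<in>{1..n}. \<exists>x\<in>{1..n}. \<exists>y\<in>{1..n}. \<exists>z\<in>{1..n}.
     w \<le> g w \<and> g w < x \<and> x < y \<and> y \<le> g x \<and> g x < z \<and> z \<le> g y \<and> closes_before g y z"
    by blast
qed

text \<open>The first arc is obtained as for \<open>P2\<close>, the last one is arc \<open>n\<close>
  as for \<open>P3\<close>.\<close>

lemma contains_P5_iff:
  "contains_pattern (decode n g) P5 \<longleftrightarrow>
    (\<exists>x\<in>{1..n}. \<exists>y\<in>{1..n}. separated (g ` {1..n}) x y \<and> y \<le> g x \<and> g x \<le> g y \<and> g y < n)"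
  unfolding contains_P5_decode[OF g]
proof safe
  fix w x y z assume "w \<in> {1..n}" "x \<in> {1..n}" "y \<in> {1..n}" "z \<in> {1..n}"
    "x \<le> g w" "g w < y" "y \<le> g x" "closes_before g x y" "g y < z"
  then show "\<exists>x\<in>{1..n}. \<exists>y\<in>{1..n}. separated (g ` {1..n}) x y \<and> y \<le> g x \<and> g x \<le> g y \<and> g y < n"
    by (intro bexI[of _ x] bexI[of _ y]) (auto simp: separated_def closes_before_def)
next
  fix x y assume xy: "x \<in> {1..n}" "y \<in> {1..n}" "separated (g ` {1..n}) x y" "y \<le> g x" "g x \<le> g y" "g y < n"
  then obtain w where w: "w \<in> {1..n}" "w < x" "x \<le> g w" "g w < y"
    using crossing_from_left g sorted by metis
  have "closes_before g x y" "n \<in> {1..n}" "n \<le> g n"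
    using w xy bnd[of n] by (auto simp: closes_before_def)
  then show "\<exists>w\<in>{1..n}. \<exists>x\<in>{1..n}. \<exists>y\<in>{1..n}. \<exists>z\<in>{1..n}.
     w < x \<and> x \<le> g w \<and> g w < y \<and> y \<le> g x \<and> closes_before g x y \<and> g y < z \<and> z \<le> g z"
    using w xy by blast
qed

end

lemma card_stoimenow_avoiding:
  "card (stoimenow_avoiding n P) =
    card {g \<in> slot_maps n. runs_sorted n g \<and> \<not> contains_pattern (decode n g) P}"
proof -
  let ?G = "{g \<in> slot_maps n. runs_sorted n g \<and> \<not> contains_pattern (decode n g) P}"
  have "bij_betw (decode n) ?G (stoimenow_avoiding n P)"
  proof (rule bij_betw_subset[OF decode_bij_betw])
    have im: "stoimenow_matchings n = decode n ` {g \<in> slot_maps n. runs_sorted n g}"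
      using bij_betw_imp_surj_on[OF decode_bij_betw] by (rule sym)
    show "decode n ` ?G = stoimenow_avoiding n P"
      unfolding stoimenow_avoiding_def im by auto
  qed auto
  then show ?thesis by (simp add: bij_betw_same_card)
qed

section \<open>Reflection\<close>

definition reflect :: "nat \<Rightarrow> nat set set \<Rightarrow> nat set set" where
  "reflect m M = (\<lambda>A. (\<lambda>x. Suc m - x) ` A) ` M"

lemma inj_on_reflection: "inj_on (\<lambda>x. Suc m - x) {1..m}"
  by (auto simp: inj_on_def)

lemma reflection_image: "(\<lambda>x. Suc m - x) ` {1..m} = {1..m}"
  by (rule card_subset_eq) (auto simp: card_image[OF inj_on_reflection, simplified])

lemma reflect_reflect:
  assumes "\<Union>M \<subseteq> {1..m}"
  shows "reflect m (reflect m M) = M"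
proof -
  have "(\<lambda>x. Suc m - x) ` (\<lambda>x. Suc m - x) ` A = A" if "A \<in> M" for A
  proof -
    have "Suc m - (Suc m - x) = x" if "x \<in> A" for x
      using that \<open>A \<in> M\<close> assms by fastforce
    then show ?thesis by (force simp: image_iff)
  qed
  then show ?thesis unfolding reflect_def by (force simp: image_iff)
qed

lemma matching_reflect:
  assumes "matching n M" shows "matching n (reflect (2 * n) M)"
proof -
  let ?f = "\<lambda>x. Suc (2 * n) - x"
  note inj = inj_on_reflection[of "2 * n"]
  have M: "partition_on {1..2 * n} M" "\<And>A. A \<in> M \<Longrightarrow> card A = 2" "\<And>A. A \<in> M \<Longrightarrow> A \<subseteq> {1..2 * n}"
    using assms by (auto simp: matching_def partition_on_def)
  have "{} \<notin> (`) ?f ` M" using M(2) by force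
  then have "partition_on {1..2 * n} (reflect (2 * n) M)"
    using partition_on_inj_image[OF M(1) inj] unfolding reflection_image by (simp add: reflect_def)
  moreover have "card (?f ` A) = 2" if "A \<in> M" for A
    using M(2,3)[OF that] card_image[OF inj_on_subset[OF inj]] by metis
  ultimately show ?thesis by (auto simp: matching_def reflect_def)
qed

lemma is_arc_reflect:
  assumes "is_arc M a b" "b \<le> m"
  shows "is_arc (reflect m M) (Suc m - b) (Suc m - a)"
proof -
  from assms have "{a, b} \<in> M" "a < b" by (auto simp: is_arc_def)
  then have "(\<lambda>x. Suc m - x) ` {a, b} \<in> reflect m M" unfolding reflect_def by blast
  with \<open>a < b\<close> assms(2) show ?thesis by (auto simp: is_arc_def insert_commute)
qed

text \<open>Reversal turns adjacent openers into adjacent closers and keeps nesting.\<close>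

lemma type_I_reflect:
  assumes "matching n M" "type_I M" shows "type_II (reflect (2 * n) M)"
proof -
  obtain i k l where arcs: "is_arc M i l" "is_arc M (i + 1) k" and kl: "i + 1 < k" "k < l"
    using assms(2) unfolding type_I_def by blast
  have "l \<le> 2 * n" using assms(1) arcs(1) by (auto simp: matching_def partition_on_def is_arc_def)
  then have "is_arc (reflect (2 * n) M) (Suc (2 * n) - l) (2 * n - i + 1)"
    "is_arc (reflect (2 * n) M) (Suc (2 * n) - k) (2 * n - i)"
    using is_arc_reflect[OF arcs(1), of "2 * n"] is_arc_reflect[OF arcs(2), of "2 * n"] kl
    by (simp_all add: Suc_diff_le)
  moreover have "Suc (2 * n) - l < Suc (2 * n) - k" "Suc (2 * n) - k < 2 * n - i"
    using kl \<open>l \<le> 2 * n\<close> by auto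
  ultimately show ?thesis unfolding type_II_def by blast
qed

lemma type_II_reflect:
  assumes "matching n M" "type_II M" shows "type_I (reflect (2 * n) M)"
proof -
  obtain j k l where arcs: "is_arc M k (j + 1)" "is_arc M l j" and kl: "k < l" "l < j"
    using assms(2) unfolding type_II_def by blast
  have "j + 1 \<le> 2 * n" using assms(1) arcs(1) by (auto simp: matching_def partition_on_def is_arc_def)
  then have "is_arc (reflect (2 * n) M) (2 * n - j) (Suc (2 * n) - k)"
    "is_arc (reflect (2 * n) M) (2 * n - j + 1) (Suc (2 * n) - l)"
    using is_arc_reflect[OF arcs(1), of "2 * n"] is_arc_reflect[OF arcs(2), of "2 * n"]
    by (simp_all add: Suc_diff_le)
  moreover have "2 * n - j + 1 < Suc (2 * n) - l" "Suc (2 * n) - l < Suc (2 * n) - k"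
    using kl \<open>j + 1 \<le> 2 * n\<close> by auto
  ultimately show ?thesis unfolding type_I_def by blast
qed

lemma contains_pattern_reflect:
  assumes M: "\<Union>M \<subseteq> {1..N}" and P: "\<Union>P = {1..m}" and "contains_pattern M P"
  shows "contains_pattern (reflect N M) (reflect m P)"
proof -
  have fin: "finite (\<Union>M)" using M by (rule finite_subset) simp
  obtain e where e: "strict_mono_on {1..m} e" "(\<lambda>A. e ` A) ` P \<subseteq> M"
    using assms(3) contains_pattern_iff[OF fin P] by blast
  have range: "e i \<in> {1..N}" if "i \<in> {1..m}" for i
  proof -
    have "i \<in> \<Union>P" using that unfolding P .
    then obtain A where "A \<in> P" "i \<in> A" by blast
    then have "e i \<in> \<Union>M" using e(2) by blast
    then show ?thesis using M by blast
  qed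
  \<comment> \<open>Conjugating the embedding by the two reversals keeps it increasing.\<close>
  define e' where "e' i = Suc N - e (Suc m - i)" for i
  have mono: "strict_mono_on {1..m} e'"
  proof (rule strict_mono_onI)
    fix r s assume rs: "r \<in> {1..m}" "s \<in> {1..m}" "r < s"
    then have "e (Suc m - s) < e (Suc m - r)" by (intro strict_mono_onD[OF e(1)]) auto
    moreover have "e (Suc m - r) \<in> {1..N}" using rs by (intro range) auto
    ultimately show "e' r < e' s" unfolding e'_def by auto
  qed
  have sub: "(\<lambda>A. e' ` A) ` reflect m P \<subseteq> reflect N M"
  proof -
    have "e' ` (\<lambda>x. Suc m - x) ` A = (\<lambda>x. Suc N - x) ` e ` A" if "A \<in> P" for A
    proof -
      have "Suc m - (Suc m - x) = x" if "x \<in> A" for x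
      proof -
        have "x \<in> {1..m}" using that \<open>A \<in> P\<close> unfolding P[symmetric] by blast
        then show ?thesis by simp
      qed
      then show ?thesis unfolding e'_def image_image by (intro image_cong refl) simp
    qed
    moreover have "(\<lambda>x. Suc N - x) ` e ` A \<in> reflect N M" if "A \<in> P" for A
      unfolding reflect_def using e(2) that by (intro imageI) blast
    ultimately show ?thesis by (simp add: reflect_def image_subset_iff)
  qed
  have "\<Union>(reflect N M) \<subseteq> {..Suc N}" "finite {..Suc N}" by (auto simp: reflect_def)
  then have fin': "finite (\<Union>(reflect N M))" by (rule finite_subset)
  have "\<Union>(reflect m P) = (\<lambda>x. Suc m - x) ` {1..m}" unfolding reflect_def P[symmetric] by blast
  also have "\<dots> = {1..m}" by (rule reflection_image)
  finally show ?thesis using contains_pattern_iff[OF fin'] mono sub by blast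
qed

lemma reflect_P4: "reflect 8 P4 = P5" and reflect_P5: "reflect 8 P5 = P4"
  by (simp_all add: reflect_def P4_def P5_def insert_commute)

lemma card_avoiding_P4_P5: "card (stoimenow_avoiding n P4) = card (stoimenow_avoiding n P5)"
proof (rule bij_betw_same_card)
  have U: "\<Union>M = {1..2 * n}" if "M \<in> stoimenow_matchings n" for M
    using that by (simp add: stoimenow_matchings_def matching_def partition_on_def)
  have invol: "reflect (2 * n) (reflect (2 * n) M) = M" if "M \<in> stoimenow_matchings n" for M
    using reflect_reflect U[OF that] by simp
  have closed: "reflect (2 * n) M \<in> stoimenow_matchings n" if "M \<in> stoimenow_matchings n" for M
    using that invol[OF that] matching_reflect type_I_reflect[of n "reflect (2 * n) M"]
      type_II_reflect[of n "reflect (2 * n) M"]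
    by (auto simp: stoimenow_matchings_def)
  have pat: "contains_pattern (reflect (2 * n) M) (reflect 8 P)"
    if "M \<in> stoimenow_matchings n" "\<Union>P = {1..8}" "contains_pattern M P" for M P
    by (rule contains_pattern_reflect[OF _ that(2,3)]) (simp add: U[OF that(1)])
  show "bij_betw (reflect (2 * n)) (stoimenow_avoiding n P4) (stoimenow_avoiding n P5)"
  proof (rule bij_betw_byWitness[where f' = "reflect (2 * n)"])
    \<comment> \<open>An occurrence of \<open>P5\<close> in the reflected matching reflects back to
      an occurrence of \<open>P4\<close> in the original one.\<close>
    show "reflect (2 * n) ` stoimenow_avoiding n P4 \<subseteq> stoimenow_avoiding n P5"
      using closed invol pat[OF closed Union_P(5)] unfolding stoimenow_avoiding_def reflect_P5
      by fastforce
    show "reflect (2 * n) ` stoimenow_avoiding n P5 \<subseteq> stoimenow_avoiding n P4"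
      using closed invol pat[OF closed Union_P(4)] unfolding stoimenow_avoiding_def reflect_P4
      by fastforce
  qed (auto simp: stoimenow_avoiding_def invol)
qed

section \<open>Counting the avoiders of each of the five patterns\<close>

theorem theorem1p1:
  fixes P :: "nat set set" and n :: nat
  assumes "P \<in> {P1, P2, P3, P4, P5}"
  shows "real (card (stoimenow_avoiding n P)) = catalan n"
proof -
  have "(real n + 1) * card (bounded_monotone n n) = (2 * n) choose n"
    using card_bounded_monotone[of n n] by (simp add: mult_2)
  then have cat: "real (card (bounded_monotone n n)) = catalan n"
    unfolding catalan_def by (simp add: field_simps)
  have P1: "card (stoimenow_avoiding n P1) = card (bounded_monotone n n)"
    by (simp add: card_stoimenow_avoiding avoid_P1)
  have "card (stoimenow_avoiding n P2) = card (strict_avoiders separated n)"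
    unfolding card_stoimenow_avoiding strict_avoiders_def using contains_P2_iff
    by (intro arg_cong[of _ _ card] Collect_cong) blast
  \<comment> \<open>Both sides count the fibre-size sequences of slot maps, since either priority
    order is injective.\<close>
  also have eq: "\<dots> = card (bounded_monotone n n)"
    unfolding greedy_recent_first[symmetric] greedy_monotone[symmetric]
    using card_greedy_maps[OF inj_recent_first] card_greedy_maps[of "\<lambda>_ a. a" n, OF inj_on_id2]
    by simp
  finally have P2: "card (stoimenow_avoiding n P2) = card (bounded_monotone n n)" .
  have "card (stoimenow_avoiding n P5) = card (weak_avoiders separated n)"
    unfolding card_stoimenow_avoiding weak_avoiders_def using contains_P5_iff
    by (intro arg_cong[of _ _ card] Collect_cong) blast
  then have P5: "card (stoimenow_avoiding n P5) = card (bounded_monotone n n)"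
    using blocking.card_weak_avoiders[OF blocking_separated, of n] eq by simp
  have P4: "card (stoimenow_avoiding n P4) = card (bounded_monotone n n)"
    using card_avoiding_P4_P5 P5 by simp
  have "card (stoimenow_avoiding n P3) = card (weak_avoiders past_first n)"
    unfolding card_stoimenow_avoiding weak_avoiders_def using contains_P3_iff
    by (intro arg_cong[of _ _ card] Collect_cong) blast
  also have "\<dots> = card (strict_avoiders past_first n)"
    by (rule blocking.card_weak_avoiders[OF blocking_past_first])
  \<comment> \<open>\<open>P4\<close> is the strict counterpart of \<open>P3\<close> for
    \<open>past_first\<close>, and its count is already known by reflection from
    \<open>P5\<close>.\<close>
  also have "\<dots> = card (stoimenow_avoiding n P4)"
    unfolding card_stoimenow_avoiding strict_avoiders_def using contains_P4_iff
    by (intro arg_cong[of _ _ card] Collect_cong) blast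
  finally have "card (stoimenow_avoiding n P3) = card (bounded_monotone n n)" using P4 by simp
  with P1 P2 P4 P5 assms cat show ?thesis by auto
qed

end
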